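(* Let $n\ge2$. Let $\mathcal{O}_1$ denote the Adjoint orbit of $C^\infty(S^1,SL(n,\mathbb{R}))$ on $C^\infty(S^1,sl(n,\mathbb{R}))$ at the constant loop $e_{1n}$, let $\tau_1$ be the orbit symplectic form on $\mathcal{O}_1$, and let $\mathfrak{k}_1:\mathcal{M}_n(S^1)\to\mathcal{O}_1$ be the map $\mathfrak{k}_1(\gamma)=g\,e_{1n}\,g^{-1}$, where $g$ is the central affine moving frame along $\gamma$. Then $\mathfrak{k}_1^*\tau_1=\hat w_3$.
   Context: $\mathcal{M}_n(S^1)$ is the set of smooth $\gamma:S^1\to\mathbb{R}^n\setminus\{0\}$ with $\det(\gamma,\gamma_x,\ldots,\gamma_x^{(n-1)})=1$; the central affine moving frame along $\gamma$ is $g=(\gamma,\gamma_x,\ldots,\gamma_x^{(n-1)})$. Tangent vectors $\delta\gamma$ at $\gamma$ are the smooth maps $S^1\to\mathbb{R}^n$ satisfying the linearization of $\det(\gamma,\ldots,\gamma_x^{(n-1)})=1$; for such $\delta\gamma$ put $\delta g=(\delta\gamma,(\delta\gamma)_x,\ldots,(\delta\gamma)_x^{(n-1)})$ (so $g^{-1}\delta g$ is $sl(n,\mathbb{R})$-valued). Let $\langle\xi,\eta\rangle=\oint\mathrm{tr}(\xi(x)\eta(x))\,dx$ on $C^\infty(S^1,sl(n,\mathbb{R}))$. The 2-form $\hat w_3$ on $\mathcal{M}_n(S^1)$ is $$(\hat w_3)_\gamma(\delta_1\gamma,\delta_2\gamma)=\langle[e_{1n},g^{-1}\delta_1g],\,g^{-1}\delta_2g\rangle.$$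 Adjoint orbits are identified with co-Adjoint orbits via $\langle\,,\rangle$; the orbit symplectic form is $\tau_\ell(\tilde\xi(\ell),\tilde\eta(\ell))=\ell([\xi,\eta])$, where $\tilde\xi,\tilde\eta$ are the infinitesimal vector fields of the action generated by $\xi,\eta$; thus on $\mathcal{O}_1$, $\tilde\xi(y)=[\xi,y]$ and $(\tau_1)_y([\xi,y],[\eta,y])=\langle y,[\xi,\eta]\rangle$. *)

theory Defs
  imports "HOL-Analysis.Analysis"
begin

text \<open>
  The circle is the real line modulo \<open>2\<pi>\<close>: a loop is a \<open>2\<pi>\<close>-periodic function on the reals.
  The dimension \<open>n\<close> is \<open>CARD('n)\<close>; the linear order on \<open>'n\<close> provides the numbering of
  rows and columns, \<open>Min UNIV\<close> being the first index and \<open>Max UNIV\<close> the \<open>n\<close>-th one.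
\<close>

type_synonym 'n rvec = "(real, 'n) vec"
type_synonym 'n sqmat = "((real, 'n) vec, 'n) vec"

definition loop_deriv :: "nat \<Rightarrow> (real \<Rightarrow> 'a::real_normed_vector) \<Rightarrow> real \<Rightarrow> 'a" where
  "loop_deriv k f = ((\<lambda>h x. vector_derivative h (at x)) ^^ k) f"

definition smooth_loops :: "(real \<Rightarrow> 'a::real_normed_vector) set" where
  "smooth_loops = {f. (\<forall>k x. loop_deriv k f differentiable (at x)) \<and> (\<forall>x. f (x + 2 * pi) = f x)}"

definition SL_loops :: "(real \<Rightarrow> 'n::finite sqmat) set" where
  "SL_loops = {h \<in> smooth_loops. \<forall>x. det (h x) = 1}"

definition sl_loops :: "(real \<Rightarrow> 'n::finite sqmat) set" where
  "sl_loops = {\<xi> \<in> smooth_loops. \<forall>x. trace (\<xi> x) = 0}"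

definition bracket :: "'n sqmat \<Rightarrow> 'n sqmat \<Rightarrow> 'n::finite sqmat" where
  "bracket A B = A ** B - B ** A"

definition pairing ::
    "(real \<Rightarrow> 'n sqmat) \<Rightarrow> (real \<Rightarrow> 'n::finite sqmat) \<Rightarrow> real" where
  "pairing \<xi> \<eta> = integral {0..2 * pi} (\<lambda>x. trace (\<xi> x ** \<eta> x))"

definition e1n :: "'n::{finite,linorder} sqmat" where
  "e1n = (\<chi> i j. if i = Min UNIV \<and> j = Max UNIV then 1 else 0)"

text \<open>
  \<open>frame \<gamma> x\<close> is the matrix whose successive columns are \<open>\<gamma>(x), \<gamma>'(x), \<dots>\<close>, the
  \<open>(n-1)\<close>-st derivative; \<open>card {k. k < j}\<close> is the zero-based position of the index \<open>j\<close>.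
  It serves both for \<open>g\<close> (applied to \<open>\<gamma>\<close>) and for \<open>\<delta>g\<close> (applied to \<open>\<delta>\<gamma>\<close>).
\<close>

definition frame ::
    "(real \<Rightarrow> 'n rvec) \<Rightarrow> real \<Rightarrow> 'n::{finite,linorder} sqmat" where
  "frame \<gamma> x = (\<chi> i j. loop_deriv (card {k. k < j}) \<gamma> x $ i)"

definition central_affine_curves :: "(real \<Rightarrow> 'n::{finite,linorder} rvec) set" where
  "central_affine_curves =
     {\<gamma> \<in> smooth_loops. (\<forall>x. \<gamma> x \<noteq> 0) \<and> (\<forall>x. det (frame \<gamma> x) = 1)}"

definition tangent_vectors ::
    "(real \<Rightarrow> 'n::{finite,linorder} rvec) \<Rightarrow> (real \<Rightarrow> 'n rvec) set" where
  "tangent_vectors \<gamma> =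
     {\<delta> \<in> smooth_loops.
        \<forall>x. ((\<lambda>s. det (frame (\<lambda>t. \<gamma> t + s *\<^sub>R \<delta> t) x)) has_real_derivative 0) (at 0)}"

text \<open>
  Differentiability at parameter \<open>0\<close> of a curve of loops, for the Frechet topology of
  smooth loops (uniform convergence of all derivatives): \<open>\<delta>\<close> is its velocity.
\<close>

definition has_velocity ::
    "(real \<Rightarrow> real \<Rightarrow> 'a::real_normed_vector) \<Rightarrow> (real \<Rightarrow> 'a) \<Rightarrow> bool" where
  "has_velocity \<Gamma> \<delta> \<longleftrightarrow> \<delta> \<in> smooth_loops \<and>
     (\<forall>k. uniform_limit UNIV
            (\<lambda>s x. (1 / s) *\<^sub>R (loop_deriv k (\<Gamma> s) x - loop_deriv k (\<Gamma> 0) x))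
            (loop_deriv k \<delta>) (at 0))"

text \<open>
  The differential at \<open>\<gamma>\<close> of a map \<open>\<Phi>\<close> defined on a set \<open>M\<close> of loops: it sends the velocity
  of any curve in \<open>M\<close> through \<open>\<gamma>\<close> to the velocity of the image curve under \<open>\<Phi>\<close>.
\<close>

definition differential ::
    "(real \<Rightarrow> 'a::real_normed_vector) set \<Rightarrow> ((real \<Rightarrow> 'a) \<Rightarrow> real \<Rightarrow> 'b::real_normed_vector)
       \<Rightarrow> (real \<Rightarrow> 'a) \<Rightarrow> (real \<Rightarrow> 'a) \<Rightarrow> real \<Rightarrow> 'b" where
  "differential M \<Phi> \<gamma> \<delta> =
     (THE Y. \<forall>\<Gamma>. \<Gamma> 0 = \<gamma> \<and> (\<forall>\<^sub>F s in nhds 0. \<Gamma> s \<in> M) \<and> has_velocity \<Gamma> \<delta>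
                  \<longrightarrow> has_velocity (\<lambda>s. \<Phi> (\<Gamma> s)) Y)"

definition pullback ::
    "(real \<Rightarrow> 'a::real_normed_vector) set \<Rightarrow> ((real \<Rightarrow> 'a) \<Rightarrow> real \<Rightarrow> 'b::real_normed_vector)
       \<Rightarrow> ((real \<Rightarrow> 'b) \<Rightarrow> (real \<Rightarrow> 'b) \<Rightarrow> (real \<Rightarrow> 'b) \<Rightarrow> real)
       \<Rightarrow> (real \<Rightarrow> 'a) \<Rightarrow> (real \<Rightarrow> 'a) \<Rightarrow> (real \<Rightarrow> 'a) \<Rightarrow> real" where
  "pullback M \<Phi> \<omega> \<gamma> \<delta>\<^sub>1 \<delta>\<^sub>2 =
     \<omega> (\<Phi> \<gamma>) (differential M \<Phi> \<gamma> \<delta>\<^sub>1) (differential M \<Phi> \<gamma> \<delta>\<^sub>2)"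

definition adjoint_orbit ::
    "(real \<Rightarrow> 'n::finite sqmat) \<Rightarrow> (real \<Rightarrow> 'n sqmat) set" where
  "adjoint_orbit y = {\<lambda>x. h x ** y x ** matrix_inv (h x) | h. h \<in> SL_loops}"

text \<open>
  The orbit symplectic form at \<open>y\<close> on a pair of tangent vectors \<open>Y = [\<xi>, y]\<close>, \<open>Z = [\<eta>, y]\<close>
  of the orbit; the value does not depend on the choice of the generators \<open>\<xi>, \<eta>\<close>.
\<close>

definition orbit_form ::
    "(real \<Rightarrow> 'n::finite sqmat) \<Rightarrow> (real \<Rightarrow> 'n sqmat) \<Rightarrow> (real \<Rightarrow> 'n sqmat)
       \<Rightarrow> real" where
  "orbit_form y Y Z =
     (THE c. \<exists>\<xi>\<in>sl_loops. \<exists>\<eta>\<in>sl_loops.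
        Y = (\<lambda>x. bracket (\<xi> x) (y x)) \<and> Z = (\<lambda>x. bracket (\<eta> x) (y x)) \<and>
        c = pairing y (\<lambda>x. bracket (\<xi> x) (\<eta> x)))"

definition O1 :: "(real \<Rightarrow> 'n::{finite,linorder} sqmat) set" where
  "O1 = adjoint_orbit (\<lambda>x. e1n)"

definition k1 ::
    "(real \<Rightarrow> 'n rvec) \<Rightarrow> real \<Rightarrow> 'n::{finite,linorder} sqmat" where
  "k1 \<gamma> x = frame \<gamma> x ** e1n ** matrix_inv (frame \<gamma> x)"

definition w3_hat ::
    "(real \<Rightarrow> 'n::{finite,linorder} rvec) \<Rightarrow> (real \<Rightarrow> 'n rvec) \<Rightarrow> (real \<Rightarrow> 'n rvec)
       \<Rightarrow> real" where
  "w3_hat \<gamma> \<delta>\<^sub>1 \<delta>\<^sub>2 =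
     pairing (\<lambda>x. bracket e1n (matrix_inv (frame \<gamma> x) ** frame \<delta>\<^sub>1 x))
             (\<lambda>x. matrix_inv (frame \<gamma> x) ** frame \<delta>\<^sub>2 x)"

end

theory Submission
  imports Defs
begin

text \<open>
  Along a curve in the space of central affine curves, differentiating \<open>k\<^sub>1 g = g e\<^sub>1\<^sub>n\<close> shows that
  the differential of \<open>k\<^sub>1\<close> at \<open>\<gamma>\<close> sends \<open>\<delta>\<close> to \<open>[\<xi>, k\<^sub>1(\<gamma>)]\<close> with \<open>\<xi> = \<delta>g g\<^sup>-\<^sup>1\<close>; conjugating by \<open>g\<close>
  under the trace turns \<open>\<langle>g e\<^sub>1\<^sub>n g\<^sup>-\<^sup>1, [\<xi>\<^sub>1, \<xi>\<^sub>2]\<rangle>\<close> into the form \<open>w\<^sub>3\<close>. The differential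
  is determined only because every tangent vector \<open>\<delta>\<close> is the velocity of a curve of central affine
  curves: a Wronskian satisfies \<open>W(l f) = l\<^sup>n W(f)\<close>, so \<open>D\<^sub>s\<^sup>-\<^sup>1\<^sup>/\<^sup>n (\<gamma> + s \<delta>)\<close> with
  \<open>D\<^sub>s = W(\<gamma> + s \<delta>)\<close> is such a curve, the factor having velocity \<open>0\<close> because \<open>\<delta>\<close> is tangent.
\<close>

subsection \<open>Smooth loops\<close>

text \<open>Naming a single derivative lets \<open>loop_deriv\<close> be peeled from either end:
  inductions on the order of smoothness remove the innermost derivative, explicit formulas are built
  with the outermost one.\<close>

definition vderiv :: "(real \<Rightarrow> 'a::real_normed_vector) \<Rightarrow> real \<Rightarrow> 'a" where
  "vderiv f = (\<lambda>x. vector_derivative f (at x))"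

lemma loop_deriv_0 [simp]: "loop_deriv 0 f = f"
  by (simp add: loop_deriv_def)

lemma loop_deriv_Suc: "loop_deriv (Suc k) f = loop_deriv k (vderiv f)"
  by (simp add: loop_deriv_def vderiv_def funpow_Suc_right del: funpow.simps)

lemma loop_deriv_Suc': "loop_deriv (Suc k) f = vderiv (loop_deriv k f)"
  by (simp add: loop_deriv_def vderiv_def)

lemma has_vderiv: "f differentiable at x \<Longrightarrow> (f has_vector_derivative vderiv f x) (at x)"
  by (simp add: vderiv_def vector_derivative_works)

lemma vderiv_eqI: "(\<And>x. (f has_vector_derivative g x) (at x)) \<Longrightarrow> vderiv f = g"
  by (auto simp: vderiv_def vector_derivative_at)

lemma vderiv_const [simp]: "vderiv (\<lambda>x. c) = (\<lambda>x. 0)"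
  by (rule vderiv_eqI) auto

text \<open>Smoothness is stratified by order so that closure under products and powers can be
  proved by induction with the functions left arbitrary: differentiating yields an expression of the
  same kind with one order less to check.\<close>

definition smooth_upto :: "nat \<Rightarrow> (real \<Rightarrow> 'a::real_normed_vector) \<Rightarrow> bool" where
  "smooth_upto k f \<longleftrightarrow> (\<forall>j<k. \<forall>x. loop_deriv j f differentiable at x)"

lemma smooth_upto_0 [simp]: "smooth_upto 0 f"
  by (simp add: smooth_upto_def)

lemma smooth_upto_Suc:
  "smooth_upto (Suc k) f \<longleftrightarrow> (\<forall>x. f differentiable at x) \<and> smooth_upto k (vderiv f)"
  by (auto simp: smooth_upto_def All_less_Suc2 loop_deriv_Suc)

lemma smooth_upto_mono: "smooth_upto k f \<Longrightarrow> j \<le> k \<Longrightarrow> smooth_upto j f"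
  by (auto simp: smooth_upto_def)

lemma smooth_loops_iff:
  "f \<in> smooth_loops \<longleftrightarrow> (\<forall>k. smooth_upto k f) \<and> (\<forall>x. f (x + 2 * pi) = f x)"
  by (auto simp: smooth_loops_def smooth_upto_def)

lemma smooth_loops_differentiable: "f \<in> smooth_loops \<Longrightarrow> f differentiable at x"
  by (metis (no_types, lifting) smooth_loops_def loop_deriv_0 mem_Collect_eq)

lemma smooth_loops_has_vderiv:
  "f \<in> smooth_loops \<Longrightarrow> (f has_vector_derivative vderiv f x) (at x)"
  by (rule has_vderiv[OF smooth_loops_differentiable])

text \<open>The derivative inherits the period through the chain rule for the translation by
  \<open>2 * pi\<close>.\<close>

lemma vderiv_smooth_loops:
  assumes "f \<in> smooth_loops"
  shows "vderiv f \<in> smooth_loops"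
proof -
  have "vderiv f (x + 2 * pi) = vderiv f x" for x
  proof -
    have "((f \<circ> (\<lambda>t. t + 2 * pi)) has_vector_derivative 1 *\<^sub>R vderiv f (x + 2 * pi)) (at x)"
      by (rule vector_diff_chain_at) (auto intro!: derivative_eq_intros smooth_loops_has_vderiv assms)
    moreover have "f \<circ> (\<lambda>t. t + 2 * pi) = f"
      using assms by (auto simp: smooth_loops_def)
    ultimately show ?thesis
      by (simp add: vderiv_def vector_derivative_at)
  qed
  then show ?thesis
    using assms smooth_upto_Suc by (auto simp: smooth_loops_iff)
qed

lemma loop_deriv_smooth_loops: "f \<in> smooth_loops \<Longrightarrow> loop_deriv k f \<in> smooth_loops"
  by (induction k) (auto simp: loop_deriv_Suc' vderiv_smooth_loops)

text \<open>Periodicity brings every value into the compact interval \<open>{0..2 * pi}\<close>,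
  where continuity bounds it. Products of uniform limits rely on this bound.\<close>

lemma smooth_loops_bounded:
  assumes "f \<in> smooth_loops"
  shows "bounded (range f)"
proof -
  interpret periodic_fun_simple f "2 * pi"
    using assms by unfold_locales (simp add: smooth_loops_def)
  have "range f \<subseteq> f ` {0..2 * pi}"
  proof clarify
    fix x
    define m where "m = \<lfloor>x / (2 * pi)\<rfloor>"
    have "of_int m \<le> x / (2 * pi)" "x / (2 * pi) < of_int m + 1"
      unfolding m_def by linarith+
    then have "x - of_int m * (2 * pi) \<in> {0..2 * pi}"
      by (auto simp: field_simps)
    moreover have "f (x - of_int m * (2 * pi)) = f x"
      by (rule minus_of_int)
    ultimately show "f x \<in> f ` {0..2 * pi}"
      by (metis image_eqI)
  qed
  moreover have "continuous_on {0..2 * pi} f"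
    using smooth_loops_differentiable[OF assms]
    by (meson continuous_at_imp_continuous_on differentiable_imp_continuous_within)
  then have "bounded (f ` {0..2 * pi})"
    by (intro compact_imp_bounded compact_continuous_image) auto
  ultimately show ?thesis
    by (rule bounded_subset[rotated])
qed

section \<open>Closure properties of smooth loops\<close>

lemma smooth_loops_const: "(\<lambda>x. c) \<in> smooth_loops"
proof -
  have "smooth_upto k (\<lambda>x. c)" for k and c :: 'a
    by (induction k arbitrary: c) (auto simp: smooth_upto_Suc)
  then show ?thesis
    by (auto simp: smooth_loops_iff)
qed

lemma vderiv_linear:
  assumes "bounded_linear h" "f \<in> smooth_loops"
  shows "vderiv (\<lambda>x. h (f x)) = (\<lambda>x. h (vderiv f x))"
  by (rule vderiv_eqI, rule bounded_linear.has_vector_derivative[OF assms(1)],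
      rule smooth_loops_has_vderiv[OF assms(2)])

lemma loop_deriv_linear:
  assumes "bounded_linear h" "f \<in> smooth_loops"
  shows "loop_deriv k (\<lambda>x. h (f x)) = (\<lambda>x. h (loop_deriv k f x))"
  by (induction k) (simp_all add: loop_deriv_Suc' vderiv_linear assms loop_deriv_smooth_loops)

lemma smooth_loops_linear:
  assumes h: "bounded_linear h" and f: "f \<in> smooth_loops"
  shows "(\<lambda>x. h (f x)) \<in> smooth_loops"
proof -
  have "(\<lambda>x. h (loop_deriv k f x)) differentiable at x" for k x
    using bounded_linear.has_vector_derivative[OF h smooth_loops_has_vderiv[OF loop_deriv_smooth_loops[OF f]]]
    by (rule differentiableI_vector)
  then show ?thesis
    using f by (simp add: smooth_loops_def loop_deriv_linear[OF h f])
qed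

lemma vderiv_add:
  assumes "f \<in> smooth_loops" "g \<in> smooth_loops"
  shows "vderiv (\<lambda>x. f x + g x) = (\<lambda>x. vderiv f x + vderiv g x)"
  by (intro vderiv_eqI has_vector_derivative_add assms smooth_loops_has_vderiv)

lemma loop_deriv_add:
  assumes "f \<in> smooth_loops" "g \<in> smooth_loops"
  shows "loop_deriv k (\<lambda>x. f x + g x) = (\<lambda>x. loop_deriv k f x + loop_deriv k g x)"
  by (induction k) (simp_all add: loop_deriv_Suc' vderiv_add assms loop_deriv_smooth_loops)

lemma vderiv_mult:
  fixes f g :: "real \<Rightarrow> real"
  assumes "\<And>x. f differentiable at x" "\<And>x. g differentiable at x"
  shows "vderiv (\<lambda>x. f x * g x) = (\<lambda>x. f x * vderiv g x + vderiv f x * g x)"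
  by (intro vderiv_eqI has_vector_derivative_mult assms has_vderiv)

lemma smooth_upto_add:
  assumes "smooth_upto k f" "smooth_upto k g"
  shows "smooth_upto k (\<lambda>x. f x + g x)"
  using assms
proof (induction k arbitrary: f g)
  case (Suc k)
  then have d: "f differentiable at x" "g differentiable at x" for x
    by (auto simp: smooth_upto_Suc)
  have "vderiv (\<lambda>x. f x + g x) = (\<lambda>x. vderiv f x + vderiv g x)"
    by (intro vderiv_eqI has_vector_derivative_add has_vderiv d)
  then show ?case
    using Suc by (simp add: smooth_upto_Suc d differentiable_add)
qed simp

lemma smooth_loops_add:
  "f \<in> smooth_loops \<Longrightarrow> g \<in> smooth_loops \<Longrightarrow> (\<lambda>x. f x + g x) \<in> smooth_loops"
  by (simp add: smooth_loops_iff smooth_upto_add)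

lemma smooth_loops_sum:
  assumes "\<And>i. i \<in> A \<Longrightarrow> f i \<in> smooth_loops"
  shows "(\<lambda>x. \<Sum>i\<in>A. f i x) \<in> smooth_loops"
  using assms
  by (induction A rule: infinite_finite_induct) (auto intro: smooth_loops_add smooth_loops_const)

lemma smooth_upto_mult:
  fixes f g :: "real \<Rightarrow> real"
  assumes "smooth_upto k f" "smooth_upto k g"
  shows "smooth_upto k (\<lambda>x. f x * g x)"
  using assms
proof (induction k arbitrary: f g)
  case (Suc k)
  then have d: "f differentiable at x" "g differentiable at x" for x
    by (auto simp: smooth_upto_Suc)
  \<comment> \<open>Each Leibniz term pairs an undifferentiated factor with a differentiated one, so
    the former is weakened to the order \<open>k\<close> of the latter.\<close>
  have "smooth_upto k f" "smooth_upto k g"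
    using Suc.prems by (auto intro: smooth_upto_mono)
  then have "smooth_upto k (\<lambda>x. f x * vderiv g x + vderiv f x * g x)"
    using Suc by (intro smooth_upto_add Suc.IH) (auto simp: smooth_upto_Suc)
  then show ?case
    by (simp add: smooth_upto_Suc vderiv_mult d)
qed simp

lemma smooth_loops_mult:
  fixes f g :: "real \<Rightarrow> real"
  shows "f \<in> smooth_loops \<Longrightarrow> g \<in> smooth_loops \<Longrightarrow> (\<lambda>x. f x * g x) \<in> smooth_loops"
  by (simp add: smooth_loops_iff smooth_upto_mult)

lemma vderiv_powr:
  fixes f :: "real \<Rightarrow> real"
  assumes "\<And>x. f differentiable at x" "\<And>x. f x > 0"
  shows "vderiv (\<lambda>x. f x powr a) = (\<lambda>x. a * (f x powr (a - 1) * vderiv f x))"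
    "(\<lambda>x. f x powr a) differentiable at x"
proof -
  have d: "((\<lambda>x. f x powr a) has_vector_derivative a * (f x powr (a - 1) * vderiv f x)) (at x)" for x
  proof -
    have "(f has_real_derivative vderiv f x) (at x)"
      using has_vderiv[OF assms(1)] by (simp add: has_real_derivative_iff_has_vector_derivative)
    from DERIV_fun_powr[OF this assms(2), of a] show ?thesis
      by (simp add: has_real_derivative_iff_has_vector_derivative mult_ac)
  qed
  show "vderiv (\<lambda>x. f x powr a) = (\<lambda>x. a * (f x powr (a - 1) * vderiv f x))"
    by (rule vderiv_eqI[OF d])
  show "(\<lambda>x. f x powr a) differentiable at x"
    by (rule differentiableI_vector[OF d])
qed

lemma smooth_loops_powr:
  fixes f :: "real \<Rightarrow> real"
  assumes f: "f \<in> smooth_loops" and pos: "\<And>x. f x > 0"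
  shows "(\<lambda>x. f x powr a) \<in> smooth_loops"
proof -
  have "smooth_upto k (\<lambda>x. f x powr a)" for k a
  \<comment> \<open>The exponent must vary, since differentiation replaces \<open>a\<close> by
    \<open>a - 1\<close>.\<close>
  proof (induction k arbitrary: a)
    case (Suc k)
    have "smooth_upto k (\<lambda>x. a * (f x powr (a - 1) * vderiv f x))"
      using vderiv_smooth_loops[OF f] smooth_loops_const[of a] Suc
      by (intro smooth_upto_mult) (auto simp: smooth_loops_iff)
    then show ?case
      by (simp add: smooth_upto_Suc vderiv_powr smooth_loops_differentiable f pos)
  qed simp
  then show ?thesis
    using f by (simp add: smooth_loops_iff)
qed

text \<open>Splitting a vector into its axis components reduces vector- and matrix-valued statements
  to scalar entries, by linearity and finite sums.\<close>

lemma vec_eq_sum_axis: "(v :: 'a::real_normed_vector ^ 'n) = (\<Sum>i\<in>UNIV. axis i (v $ i))"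
  by (simp add: vec_eq_iff axis_def if_distrib cong: if_cong)

lemma bounded_linear_axis: "bounded_linear (axis i :: 'a::real_normed_vector \<Rightarrow> 'a ^ 'n)"
proof
  show "\<exists>K. \<forall>x. norm (axis i x :: 'a ^ 'n) \<le> norm x * K"
  proof (intro exI allI)
    fix x :: 'a
    have "norm (axis i x :: 'a ^ 'n) \<le> (\<Sum>j\<in>UNIV. norm ((axis i x :: 'a ^ 'n) $ j))"
      unfolding norm_vec_def by (rule L2_set_le_sum) auto
    also have "\<dots> = norm x"
      by (simp add: axis_def if_distrib cong: if_cong)
    finally show "norm (axis i x :: 'a ^ 'n) \<le> norm x * 1"
      by simp
  qed
qed (auto simp: vec_eq_iff axis_def)

lemma smooth_loops_vecI:
  fixes f :: "real \<Rightarrow> 'a::real_normed_vector ^ 'n"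
  assumes "\<And>i. (\<lambda>x. f x $ i) \<in> smooth_loops"
  shows "f \<in> smooth_loops"
proof -
  have "(\<lambda>x. \<Sum>i\<in>UNIV. axis i (f x $ i)) \<in> smooth_loops"
    by (intro smooth_loops_sum smooth_loops_linear[OF bounded_linear_axis] assms)
  then show ?thesis
    by (simp flip: vec_eq_sum_axis)
qed

lemma smooth_loops_nth: "f \<in> smooth_loops \<Longrightarrow> (\<lambda>x. f x $ i) \<in> smooth_loops"
  by (rule smooth_loops_linear[OF bounded_linear_vec_nth])

subsection \<open>Variations of smooth loops\<close>

text \<open>The ingredient of \<open>has_velocity\<close> for one order of differentiation: a
  parameter derivative at 0 that is uniform along the loop.\<close>

definition quotient_limit :: "(real \<Rightarrow> real \<Rightarrow> 'a::real_normed_vector) \<Rightarrow> (real \<Rightarrow> 'a) \<Rightarrow> bool" where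
  "quotient_limit F f \<longleftrightarrow> uniform_limit UNIV (\<lambda>s x. (1 / s) *\<^sub>R (F s x - F 0 x)) f (at 0)"

text \<open>The finite-order part of \<open>has_velocity\<close>. It serves inductions for
  variations as \<open>smooth_upto\<close> does for single loops.\<close>

definition velocity_upto :: "nat \<Rightarrow> (real \<Rightarrow> real \<Rightarrow> 'a::real_normed_vector) \<Rightarrow> (real \<Rightarrow> 'a) \<Rightarrow> bool" where
  "velocity_upto k F f \<longleftrightarrow> (\<forall>j<k. quotient_limit (\<lambda>s. loop_deriv j (F s)) (loop_deriv j f))"

text \<open>Smoothness near parameter \<open>0\<close> is not part of \<^const>\<open>has_velocity\<close>, but the product
  rule needs it.\<close>

definition smooth_variation :: "(real \<Rightarrow> real \<Rightarrow> 'a::real_normed_vector) \<Rightarrow> (real \<Rightarrow> 'a) \<Rightarrow> bool" where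
  "smooth_variation F f \<longleftrightarrow> (\<forall>\<^sub>F s in nhds 0. F s \<in> smooth_loops) \<and> has_velocity F f"

lemma smooth_variation_iff:
  "smooth_variation F f \<longleftrightarrow>
    (\<forall>\<^sub>F s in nhds 0. F s \<in> smooth_loops) \<and> f \<in> smooth_loops \<and> (\<forall>k. velocity_upto k F f)"
  by (auto simp: smooth_variation_def has_velocity_def velocity_upto_def quotient_limit_def)

lemma smooth_variation_iff':
  "smooth_variation F f \<longleftrightarrow>
    (\<forall>\<^sub>F s in nhds 0. F s \<in> smooth_loops) \<and> f \<in> smooth_loops \<and>
    (\<forall>k. quotient_limit (\<lambda>s. loop_deriv k (F s)) (loop_deriv k f))"
  by (auto simp: smooth_variation_def has_velocity_def quotient_limit_def)

lemma velocity_upto_0 [simp]: "velocity_upto 0 F f"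
  by (simp add: velocity_upto_def)

lemma velocity_upto_Suc:
  "velocity_upto (Suc k) F f \<longleftrightarrow>
    quotient_limit F f \<and> velocity_upto k (\<lambda>s. vderiv (F s)) (vderiv f)"
  by (auto simp: velocity_upto_def All_less_Suc2 loop_deriv_Suc)

lemma velocity_upto_mono: "velocity_upto k F f \<Longrightarrow> j \<le> k \<Longrightarrow> velocity_upto j F f"
  by (auto simp: velocity_upto_def)

text \<open>Formulas for the derivatives of \<open>F s\<close> hold only where \<open>F s\<close> is
  smooth, that is, for \<open>s\<close> near 0. The neighbourhood includes 0 itself because the
  quotient contains \<open>F 0\<close>.\<close>

lemma quotient_limit_cong:
  assumes "\<forall>\<^sub>F s in nhds 0. F s = G s"
  shows "quotient_limit F f \<longleftrightarrow> quotient_limit G f"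
proof -
  have "F 0 = G 0"
    using eventually_nhds_x_imp_x[OF assms] .
  moreover have "\<forall>\<^sub>F s in at 0. F s = G s"
    using assms by (simp add: eventually_at_filter eventually_mono)
  ultimately show ?thesis
    unfolding quotient_limit_def
    by (intro uniform_limit_cong) (auto elim: eventually_mono)
qed

lemma velocity_upto_cong:
  assumes "\<forall>\<^sub>F s in nhds 0. F s = G s"
  shows "velocity_upto k F f \<longleftrightarrow> velocity_upto k G f"
proof -
  have "quotient_limit (\<lambda>s. loop_deriv j (F s)) h \<longleftrightarrow> quotient_limit (\<lambda>s. loop_deriv j (G s)) h" for j h
    by (rule quotient_limit_cong) (use assms in \<open>auto elim: eventually_mono\<close>)
  then show ?thesis
    by (simp add: velocity_upto_def)
qed

lemma smooth_variation_cong: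
  assumes "\<forall>\<^sub>F s in nhds 0. F s = G s"
  shows "smooth_variation F f \<longleftrightarrow> smooth_variation G f"
proof -
  have "(\<forall>\<^sub>F s in nhds 0. F s \<in> smooth_loops) \<longleftrightarrow> (\<forall>\<^sub>F s in nhds 0. G s \<in> smooth_loops)"
    by (rule eventually_cong[OF assms]) auto
  then show ?thesis
    by (simp add: smooth_variation_iff velocity_upto_cong[OF assms])
qed

section \<open>Arithmetic of uniform difference quotients\<close>

lemma quotient_limit_add:
  assumes "quotient_limit F f" "quotient_limit G g"
  shows "quotient_limit (\<lambda>s x. F s x + G s x) (\<lambda>x. f x + g x)"
  using uniform_limit_add[OF assms[unfolded quotient_limit_def]]
  by (simp add: quotient_limit_def algebra_simps)

lemma quotient_limit_linear:
  assumes h: "bounded_linear h" and F: "quotient_limit F f"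
  shows "quotient_limit (\<lambda>s x. h (F s x)) (\<lambda>x. h (f x))"
  using bounded_linear.uniform_limit[OF h F[unfolded quotient_limit_def]]
  by (simp add: quotient_limit_def bounded_linear.linear[OF h] linear_scale linear_diff)

lemma quotient_limit_tendsto:
  "quotient_limit F f \<Longrightarrow> ((\<lambda>s. (1 / s) *\<^sub>R (F s x - F 0 x)) \<longlongrightarrow> f x) (at 0)"
  unfolding quotient_limit_def using tendsto_uniform_limitI by fastforce

lemma quotient_limit_DERIV:
  "quotient_limit F f \<Longrightarrow> ((\<lambda>s. F s x) has_real_derivative f x) (at 0)"
  using quotient_limit_tendsto[of F f x] by (simp add: DERIV_def divide_simps)

text \<open>For nonzero \<open>s\<close>, \<open>F s\<close> is \<open>F 0\<close> plus
  \<open>s\<close> times the difference quotient; the quotient tends uniformly to the bounded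
  \<open>f\<close>, so the product with \<open>s\<close> tends uniformly to 0.\<close>

lemma quotient_limit_imp_uniform_limit:
  assumes F: "quotient_limit F f" and f: "bounded (range f)"
  shows "uniform_limit UNIV F (F 0) (at 0)"
proof -
  have "uniform_limit UNIV (\<lambda>s x. s *\<^sub>R ((1 / s) *\<^sub>R (F s x - F 0 x)) + F 0 x)
          (\<lambda>x. 0 *\<^sub>R f x + F 0 x) (at (0::real))"
  proof (intro uniform_limit_add uniform_limit_const
      bounded_bilinear.bounded_uniform_limit[OF bounded_bilinear_scaleR])
    show "uniform_limit UNIV (\<lambda>s x. s) (\<lambda>x. 0) (at (0::real))"
      unfolding uniform_limit_iff eventually_at by auto
  qed (use F f in \<open>auto simp: quotient_limit_def\<close>)
  moreover have "\<forall>\<^sub>F s in at 0. \<forall>x\<in>UNIV. s *\<^sub>R ((1 / s) *\<^sub>R (F s x - F 0 x)) + F 0 x = F s x"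
    by (auto simp: eventually_at_filter)
  ultimately show ?thesis
    by (subst (asm) uniform_limit_cong) auto
qed

text \<open>The increment of the product is split as
  \<open>F 0 * (G s - G 0) + (F s - F 0) * G s\<close>; boundedness of the limits allows uniform
  limits to be multiplied.\<close>

lemma quotient_limit_mult:
  fixes F G :: "real \<Rightarrow> real \<Rightarrow> real"
  assumes F: "quotient_limit F f" and G: "quotient_limit G g"
    and bounded: "bounded (range f)" "bounded (range g)" "bounded (range (F 0))" "bounded (range (G 0))"
  shows "quotient_limit (\<lambda>s x. F s x * G s x) (\<lambda>x. F 0 x * g x + f x * G 0 x)"
proof -
  have "uniform_limit UNIV
      (\<lambda>s x. F 0 x * ((1 / s) *\<^sub>R (G s x - G 0 x)) + ((1 / s) *\<^sub>R (F s x - F 0 x)) * G s x)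
      (\<lambda>x. F 0 x * g x + f x * G 0 x) (at 0)"
    using F G bounded unfolding quotient_limit_def[of F] quotient_limit_def[of G]
    by (intro uniform_limit_add uniform_lim_mult uniform_limit_const
        quotient_limit_imp_uniform_limit[OF G])
  then show ?thesis
    by (simp add: quotient_limit_def algebra_simps)
qed

text \<open>The derivative of the power at 1 is \<open>a\<close>. Tolerance 1 in the definition of
  differentiability bounds the remainder by \<open>|y - 1|\<close>, which accounts for the 1 added
  to \<open>|a|\<close>.\<close>

lemma powr_lipschitz_at_1:
  "\<exists>d>0. \<forall>y::real. \<bar>y - 1\<bar> < d \<longrightarrow> \<bar>y powr a - 1\<bar> \<le> (\<bar>a\<bar> + 1) * \<bar>y - 1\<bar>"
proof -
  have "((\<lambda>y::real. y powr a) has_real_derivative a) (at 1)"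
    by (auto intro!: derivative_eq_intros)
  then have "((\<lambda>y::real. y powr a) has_derivative (*) a) (at 1)"
    by (simp add: has_field_derivative_def)
  then obtain d where d: "d > 0"
    "\<And>y::real. \<bar>y - 1\<bar> < d \<Longrightarrow> \<bar>y powr a - 1 - a * (y - 1)\<bar> \<le> \<bar>y - 1\<bar>"
    unfolding has_derivative_at_alt by (force dest: spec[of _ 1])
  have "\<bar>y powr a - 1\<bar> \<le> (\<bar>a\<bar> + 1) * \<bar>y - 1\<bar>" if "\<bar>y - 1\<bar> < d" for y
  proof -
    have "\<bar>y powr a - 1\<bar> \<le> \<bar>y powr a - 1 - a * (y - 1)\<bar> + \<bar>a * (y - 1)\<bar>"
      by linarith
    then show ?thesis
      using d(2)[OF that] by (simp add: abs_mult distrib_right)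
  qed
  with d(1) show ?thesis
    by blast
qed

text \<open>Uniformly near the constant 1, the Lipschitz bound dominates the quotient of the power
  by a multiple of the quotient of \<open>F\<close>, which tends to 0.\<close>

lemma quotient_limit_powr:
  fixes F :: "real \<Rightarrow> real \<Rightarrow> real"
  assumes F: "quotient_limit F (\<lambda>x. 0)" and F0: "F 0 = (\<lambda>x. 1)"
  shows "quotient_limit (\<lambda>s x. F s x powr a) (\<lambda>x. 0)"
proof -
  obtain d :: real where d: "d > 0"
    "\<And>y. \<bar>y - 1\<bar> < d \<Longrightarrow> \<bar>y powr a - 1\<bar> \<le> (\<bar>a\<bar> + 1) * \<bar>y - 1\<bar>"
    using powr_lipschitz_at_1 by blast
  have "uniform_limit UNIV F (\<lambda>x. 1) (at 0)"
    using quotient_limit_imp_uniform_limit[OF F] F0 by simp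
  then have "\<forall>\<^sub>F s in at 0. \<forall>x\<in>UNIV. \<bar>F s x - 1\<bar> < d"
    using uniform_limitD[OF _ d(1)] by (fastforce simp: dist_real_def)
  then have le: "\<forall>\<^sub>F s in at 0. \<forall>x\<in>UNIV. norm ((1 / s) *\<^sub>R (F s x powr a - F 0 x powr a))
      \<le> (\<bar>a\<bar> + 1) * norm ((1 / s) *\<^sub>R (F s x - F 0 x))"
  proof eventually_elim
    case (elim s)
    have "\<bar>1 / s\<bar> * \<bar>F s x powr a - 1\<bar> \<le> \<bar>1 / s\<bar> * ((\<bar>a\<bar> + 1) * \<bar>F s x - 1\<bar>)" for x
      by (intro mult_left_mono d(2)) (use elim in auto)
    then show ?case
      by (simp add: F0 abs_mult mult_ac)
  qed
  have "uniform_limit UNIV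
      (\<lambda>s x. (\<bar>a\<bar> + 1) * norm ((1 / s) *\<^sub>R (F s x - F 0 x))) (\<lambda>x. (\<bar>a\<bar> + 1) * norm (0::real)) (at 0)"
    using F unfolding quotient_limit_def
    by (intro bounded_linear.uniform_limit[OF bounded_linear_mult_right] uniform_limit_norm)
  then show ?thesis
    unfolding quotient_limit_def by (intro uniform_limit_null_comparison[OF le]) (simp only: norm_zero mult_zero_right)
qed

section \<open>Closure properties of smooth variations\<close>

lemma smooth_variation_smooth:
  assumes "smooth_variation F f"
  shows "\<forall>\<^sub>F s in nhds 0. F s \<in> smooth_loops" "F 0 \<in> smooth_loops" "f \<in> smooth_loops"
    "quotient_limit F f"
proof -
  show ev: "\<forall>\<^sub>F s in nhds 0. F s \<in> smooth_loops" and "f \<in> smooth_loops"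
    using assms by (auto simp: smooth_variation_iff)
  show "F 0 \<in> smooth_loops"
    using eventually_nhds_x_imp_x[OF ev] .
  have "quotient_limit (\<lambda>s. loop_deriv 0 (F s)) (loop_deriv 0 f)"
    using assms by (simp only: smooth_variation_iff')
  then show "quotient_limit F f"
    by simp
qed

lemma smooth_variation_vderiv:
  assumes "smooth_variation F f"
  shows "smooth_variation (\<lambda>s. vderiv (F s)) (vderiv f)"
proof -
  have "velocity_upto k (\<lambda>s. vderiv (F s)) (vderiv f)" for k
    using assms velocity_upto_Suc by (auto simp: smooth_variation_iff)
  then show ?thesis
    using assms unfolding smooth_variation_iff
    by (auto simp: vderiv_smooth_loops elim: eventually_mono)
qed

lemma smooth_variation_loop_deriv:
  "smooth_variation F f \<Longrightarrow> smooth_variation (\<lambda>s. loop_deriv k (F s)) (loop_deriv k f)"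
  by (induction k) (auto simp: loop_deriv_Suc' smooth_variation_vderiv)

lemma smooth_variation_const:
  assumes "f \<in> smooth_loops"
  shows "smooth_variation (\<lambda>s. f) (\<lambda>x. 0)"
proof -
  have "loop_deriv k (\<lambda>x. 0::'a) = (\<lambda>x. 0)" for k
    by (induction k) (auto simp: loop_deriv_Suc')
  then show ?thesis
    by (auto simp: smooth_variation_iff' quotient_limit_def assms smooth_loops_const
        intro: uniform_limit_const)
qed

lemma smooth_variation_linear:
  assumes h: "bounded_linear h" and F: "smooth_variation F f"
  shows "smooth_variation (\<lambda>s x. h (F s x)) (\<lambda>x. h (f x))"
proof -
  note sm = smooth_variation_smooth[OF F]
  have "quotient_limit (\<lambda>s. loop_deriv k (\<lambda>x. h (F s x))) (loop_deriv k (\<lambda>x. h (f x)))" for k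
  proof (subst quotient_limit_cong)
    show "\<forall>\<^sub>F s in nhds 0. loop_deriv k (\<lambda>x. h (F s x)) = (\<lambda>x. h (loop_deriv k (F s) x))"
      using sm(1) by eventually_elim (rule loop_deriv_linear[OF h])
    show "quotient_limit (\<lambda>s x. h (loop_deriv k (F s) x)) (loop_deriv k (\<lambda>x. h (f x)))"
      using F quotient_limit_linear[OF h, of "\<lambda>s. loop_deriv k (F s)" "loop_deriv k f"]
      by (simp add: loop_deriv_linear[OF h sm(3)] smooth_variation_iff')
  qed
  then show ?thesis
    using sm(1) unfolding smooth_variation_iff'
    by (auto intro: smooth_loops_linear[OF h] sm(3) elim: eventually_mono)
qed

lemma velocity_upto_add:
  assumes "velocity_upto k F f" "velocity_upto k G g"
    and "\<forall>\<^sub>F s in nhds 0. F s \<in> smooth_loops" "\<forall>\<^sub>F s in nhds 0. G s \<in> smooth_loops"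
    and "f \<in> smooth_loops" "g \<in> smooth_loops"
  shows "velocity_upto k (\<lambda>s x. F s x + G s x) (\<lambda>x. f x + g x)"
  unfolding velocity_upto_def
proof (intro allI impI)
  fix j assume j: "j < k"
  have "\<forall>\<^sub>F s in nhds 0. loop_deriv j (\<lambda>x. F s x + G s x) =
        (\<lambda>x. loop_deriv j (F s) x + loop_deriv j (G s) x)"
    using assms(3,4) by eventually_elim (rule loop_deriv_add)
  from quotient_limit_cong[OF this]
  show "quotient_limit (\<lambda>s. loop_deriv j (\<lambda>x. F s x + G s x)) (loop_deriv j (\<lambda>x. f x + g x))"
    using assms j by (simp add: loop_deriv_add velocity_upto_def quotient_limit_add)
qed

lemma smooth_variation_add:
  assumes F: "smooth_variation F f" and G: "smooth_variation G g"
  shows "smooth_variation (\<lambda>s x. F s x + G s x) (\<lambda>x. f x + g x)"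
proof -
  note sm = smooth_variation_smooth[OF F] smooth_variation_smooth[OF G]
  have "\<forall>\<^sub>F s in nhds 0. (\<lambda>x. F s x + G s x) \<in> smooth_loops"
    using sm(1,5) by eventually_elim (rule smooth_loops_add)
  then show ?thesis
    using F G by (simp add: smooth_variation_iff velocity_upto_add smooth_loops_add sm)
qed

lemma smooth_variation_sum:
  assumes "\<And>i. i \<in> A \<Longrightarrow> smooth_variation (F i) (f i)"
  shows "smooth_variation (\<lambda>s x. \<Sum>i\<in>A. F i s x) (\<lambda>x. \<Sum>i\<in>A. f i x)"
  using assms
  by (induction A rule: infinite_finite_induct)
    (auto intro: smooth_variation_add smooth_variation_const smooth_loops_const)

text \<open>For determinants and matrix products only the existence of a velocity is tracked; where
  its value matters, it is recovered by differentiating pointwise in the parameter.\<close>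

lemma smooth_variation_sum_ex:
  assumes "\<And>i. i \<in> A \<Longrightarrow> \<exists>f. smooth_variation (F i) f"
  shows "\<exists>f. smooth_variation (\<lambda>s x. \<Sum>i\<in>A. F i s x) f"
proof -
  obtain f where "\<And>i. i \<in> A \<Longrightarrow> smooth_variation (F i) (f i)"
    using bchoice[of A "\<lambda>i. smooth_variation (F i)"] assms by auto
  then have "smooth_variation (\<lambda>s x. \<Sum>i\<in>A. F i s x) (\<lambda>x. \<Sum>i\<in>A. f i x)"
    by (rule smooth_variation_sum)
  then show ?thesis
    by blast
qed

text \<open>The derivative along the loop is \<open>F G' + F' G\<close>, to which the induction
  hypothesis applies with one order less; the resulting four terms are exactly the derivative of the
  claimed velocity.\<close>

lemma velocity_upto_mult:
  fixes F G :: "real \<Rightarrow> real \<Rightarrow> real"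
  assumes "velocity_upto k F f" "velocity_upto k G g"
    and "\<forall>\<^sub>F s in nhds 0. F s \<in> smooth_loops" "\<forall>\<^sub>F s in nhds 0. G s \<in> smooth_loops"
    and "f \<in> smooth_loops" "g \<in> smooth_loops"
  shows "velocity_upto k (\<lambda>s x. F s x * G s x) (\<lambda>x. F 0 x * g x + f x * G 0 x)"
  using assms
proof (induction k arbitrary: F f G g)
  case (Suc k)
  note fg = \<open>f \<in> smooth_loops\<close> \<open>g \<in> smooth_loops\<close>
  note ev = Suc.prems(3,4)
  have FG0: "F 0 \<in> smooth_loops" "G 0 \<in> smooth_loops"
    using ev by (auto dest: eventually_nhds_x_imp_x)
  have ev': "\<forall>\<^sub>F s in nhds 0. vderiv (F s) \<in> smooth_loops" "\<forall>\<^sub>F s in nhds 0. vderiv (G s) \<in> smooth_loops"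
    using ev by (auto elim: eventually_mono intro: vderiv_smooth_loops)
  have evm: "\<forall>\<^sub>F s in nhds 0. (\<lambda>x. F s x * vderiv (G s) x) \<in> smooth_loops"
    "\<forall>\<^sub>F s in nhds 0. (\<lambda>x. vderiv (F s) x * G s x) \<in> smooth_loops"
    using eventually_conj[OF ev]
    by (auto elim!: eventually_mono intro!: smooth_loops_mult vderiv_smooth_loops)
  have sm: "(\<lambda>x. F 0 x * g x) \<in> smooth_loops" "(\<lambda>x. f x * G 0 x) \<in> smooth_loops"
    by (intro smooth_loops_mult fg FG0)+
  have base: "quotient_limit (\<lambda>s x. F s x * G s x) (\<lambda>x. F 0 x * g x + f x * G 0 x)"
    using Suc.prems by (intro quotient_limit_mult smooth_loops_bounded FG0) (auto simp: velocity_upto_Suc)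
  have vel: "velocity_upto k F f" "velocity_upto k G g"
    using Suc.prems by (auto intro: velocity_upto_mono)
  have vel': "velocity_upto k (\<lambda>s. vderiv (F s)) (vderiv f)" "velocity_upto k (\<lambda>s. vderiv (G s)) (vderiv g)"
    using Suc.prems by (auto simp: velocity_upto_Suc)
  have eq: "\<forall>\<^sub>F s in nhds 0. vderiv (\<lambda>x. F s x * G s x) = (\<lambda>x. F s x * vderiv (G s) x + vderiv (F s) x * G s x)"
    using ev by eventually_elim (simp add: vderiv_mult smooth_loops_differentiable)
  have "velocity_upto k (\<lambda>s x. F s x * vderiv (G s) x + vderiv (F s) x * G s x)
      (\<lambda>x. (F 0 x * vderiv g x + f x * vderiv (G 0) x) + (vderiv (F 0) x * g x + vderiv f x * G 0 x))"
    by (intro velocity_upto_add Suc.IH vel vel' ev ev' evm smooth_loops_add smooth_loops_mult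
        vderiv_smooth_loops fg FG0)
  moreover have "vderiv (\<lambda>x. F 0 x * g x + f x * G 0 x) =
      (\<lambda>x. (F 0 x * vderiv g x + f x * vderiv (G 0) x) + (vderiv (F 0) x * g x + vderiv f x * G 0 x))"
    by (simp add: vderiv_add sm vderiv_mult smooth_loops_differentiable fg FG0 add_ac)
  ultimately show ?case
    by (simp add: velocity_upto_Suc base velocity_upto_cong[OF eq])
qed simp

lemma smooth_variation_mult:
  fixes F G :: "real \<Rightarrow> real \<Rightarrow> real"
  assumes F: "smooth_variation F f" and G: "smooth_variation G g"
  shows "smooth_variation (\<lambda>s x. F s x * G s x) (\<lambda>x. F 0 x * g x + f x * G 0 x)"
proof -
  note sm = smooth_variation_smooth[OF F] smooth_variation_smooth[OF G]
  have "\<forall>\<^sub>F s in nhds 0. (\<lambda>x. F s x * G s x) \<in> smooth_loops"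
    using sm(1,5) by eventually_elim (rule smooth_loops_mult)
  then show ?thesis
    using F G
    by (simp add: smooth_variation_iff velocity_upto_mult smooth_loops_add smooth_loops_mult sm)
qed

lemma smooth_variation_prod:
  fixes F :: "'i \<Rightarrow> real \<Rightarrow> real \<Rightarrow> real"
  assumes "\<And>i. i \<in> A \<Longrightarrow> \<exists>f. smooth_variation (F i) f"
  shows "\<exists>f. smooth_variation (\<lambda>s x. \<Prod>i\<in>A. F i s x) f"
  using assms
proof (induction A rule: infinite_finite_induct)
  case (insert i A)
  then obtain f g where "smooth_variation (F i) f" "smooth_variation (\<lambda>s x. \<Prod>i\<in>A. F i s x) g"
    by (meson insertCI)
  from smooth_variation_mult[OF this] show ?case
    using insert.hyps by auto
qed (auto intro: smooth_variation_const smooth_loops_const)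

text \<open>A determinant is a polynomial in the entries, so sums and products of variations
  suffice.\<close>

lemma smooth_variation_det:
  fixes A :: "real \<Rightarrow> real \<Rightarrow> 'n::finite sqmat"
  assumes "\<And>i j. \<exists>f. smooth_variation (\<lambda>s x. A s x $ i $ j) f"
  shows "\<exists>f. smooth_variation (\<lambda>s x. det (A s x)) f"
proof -
  have "\<exists>f. smooth_variation (\<lambda>s x. of_int (sign p) * (\<Prod>i\<in>UNIV. A s x $ i $ p i)) f" for p
  proof -
    obtain f where "smooth_variation (\<lambda>s x. \<Prod>i\<in>UNIV. A s x $ i $ p i) f"
      using smooth_variation_prod[where A=UNIV and F="\<lambda>i s x. A s x $ i $ p i"] assms by auto
    from smooth_variation_linear[OF bounded_linear_mult_right this] show ?thesis
      by blast
  qed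
  then show ?thesis
    unfolding det_def by (rule smooth_variation_sum_ex)
qed

lemma smooth_variation_vecI:
  fixes F :: "real \<Rightarrow> real \<Rightarrow> 'a::real_normed_vector ^ 'n"
  assumes "\<And>i. smooth_variation (\<lambda>s x. F s x $ i) (\<lambda>x. f x $ i)"
  shows "smooth_variation F f"
proof -
  have "smooth_variation (\<lambda>s x. \<Sum>i\<in>UNIV. axis i (F s x $ i)) (\<lambda>x. \<Sum>i\<in>UNIV. axis i (f x $ i))"
    by (intro smooth_variation_sum smooth_variation_linear[OF bounded_linear_axis] assms)
  then show ?thesis
    by (simp flip: vec_eq_sum_axis)
qed

lemma smooth_variation_nth:
  "smooth_variation F f \<Longrightarrow> smooth_variation (\<lambda>s x. F s x $ i) (\<lambda>x. f x $ i)"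
  by (rule smooth_variation_linear[OF bounded_linear_vec_nth])

text \<open>Designed for the factor that normalizes a Wronskian. Its derivative along the loop is
  \<open>a\<close> times \<open>F powr (a - 1)\<close> times the derivative of \<open>F\<close>, and
  both variable factors again have velocity 0.\<close>

lemma smooth_variation_powr:
  fixes F :: "real \<Rightarrow> real \<Rightarrow> real"
  assumes F: "smooth_variation F (\<lambda>x. 0)" and F0: "F 0 = (\<lambda>x. 1)"
    and pos: "\<forall>\<^sub>F s in nhds 0. \<forall>x. F s x > 0"
  shows "smooth_variation (\<lambda>s x. F s x powr a) (\<lambda>x. 0)"
proof -
  note sm = smooth_variation_smooth[OF F]
  have powr: "\<forall>\<^sub>F s in nhds 0. (\<lambda>x. F s x powr b) \<in> smooth_loops" for b
    using sm(1) pos by eventually_elim (simp add: smooth_loops_powr)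
  have "velocity_upto k (\<lambda>s x. F s x powr a) (\<lambda>x. 0)" for k
  proof (induction k arbitrary: a)
    case (Suc k)
    have eq: "\<forall>\<^sub>F s in nhds 0. vderiv (\<lambda>x. F s x powr a) =
        (\<lambda>x. a * (F s x powr (a - 1) * vderiv (F s) x))"
      using sm(1) pos by eventually_elim (simp add: vderiv_powr smooth_loops_differentiable)
    have F': "smooth_variation (\<lambda>s. vderiv (F s)) (\<lambda>x. 0)"
      using smooth_variation_vderiv[OF F] by simp
    have ev: "\<forall>\<^sub>F s in nhds 0. (\<lambda>x. F s x powr (a - 1) * vderiv (F s) x) \<in> smooth_loops"
      using powr[of "a - 1"] smooth_variation_smooth(1)[OF F'] 
      by eventually_elim (rule smooth_loops_mult)
    \<comment> \<open>The velocity is kept in the shape produced by the product rule. One summand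
      vanishes because the derivative of \<open>F\<close> has velocity 0, the other by the induction
      hypothesis at exponent \<open>a - 1\<close>.\<close>
    have "velocity_upto k (\<lambda>s x. F s x powr (a - 1) * vderiv (F s) x) (\<lambda>x. F 0 x powr (a - 1) * 0 + 0 * vderiv (F 0) x)"
      using F' by (intro velocity_upto_mult Suc.IH powr) (auto simp: smooth_variation_iff)
    then have "velocity_upto k (\<lambda>s x. a * (F s x powr (a - 1) * vderiv (F s) x)) (\<lambda>x. a * 0 + 0 * (F 0 x powr (a - 1) * vderiv (F 0) x))"
      using smooth_variation_const[OF smooth_loops_const, of a] ev
      by (intro velocity_upto_mult) (auto simp: smooth_variation_iff)
    then show ?case
      using sm(4) by (simp add: velocity_upto_Suc velocity_upto_cong[OF eq] quotient_limit_powr F0)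
  qed simp
  then show ?thesis
    using powr by (simp add: smooth_variation_iff smooth_loops_const)
qed

subsection \<open>Wronskians and determinants\<close>

text \<open>The zero-based position of an index, hence the order of the derivative in that column of
  \<open>frame\<close>.\<close>

definition index_pos :: "'n::{finite,linorder} \<Rightarrow> nat" where
  "index_pos j = card {k. k < j}"

lemma index_pos_less: "i < j \<Longrightarrow> index_pos i < index_pos j"
  unfolding index_pos_def by (rule psubset_card_mono) auto

lemma inj_index_pos: "inj index_pos"
  by (rule linorder_injI) (use index_pos_less in force)

lemma index_pos_less_iff: "index_pos i < index_pos j \<longleftrightarrow> i < j"
  by (metis index_pos_less less_asym' linorder_neqE)

text \<open>An injection into a finite set of the same cardinality is onto. This turns Leibniz sums
  over derivative orders into matrix sums over indices.\<close>

lemma bij_betw_index_pos: "bij_betw index_pos {k. k \<le> j} {..index_pos j}"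
proof -
  have "{k. k \<le> j} = insert j {k. k < j}"
    by auto
  then have "card {k. k \<le> j} = Suc (index_pos j)"
    by (simp add: index_pos_def)
  then have "card (index_pos ` {k. k \<le> j}) = Suc (index_pos j)"
    by (simp only: card_image[OF inj_on_subset[OF inj_index_pos subset_UNIV]])
  moreover have "index_pos ` {k. k \<le> j} \<subseteq> {..index_pos j}"
    by (auto simp: not_less[symmetric] index_pos_less_iff)
  ultimately have "index_pos ` {k. k \<le> j} = {..index_pos j}"
    by (intro card_subset_eq) auto
  then show ?thesis
    by (simp add: bij_betw_def inj_on_subset[OF inj_index_pos])
qed

text \<open>A point moved strictly upwards would increase the sum of all positions, but a
  permutation preserves that sum.\<close>

lemma permutes_ge_imp_id:
  fixes p :: "'n::{finite,linorder} \<Rightarrow> 'n"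
  assumes p: "p permutes UNIV" and ge: "\<And>i. i \<le> p i"
  shows "p = id"
proof (rule ccontr)
  assume "p \<noteq> id"
  then obtain i where "i < p i"
    using ge by (metis eq_id_iff order_le_less)
  then have "(\<Sum>i\<in>(UNIV :: 'n set). index_pos i) < (\<Sum>i\<in>UNIV. index_pos (p i))"
    using ge by (intro sum_strict_mono_ex1)
      (auto simp: index_pos_less_iff not_less[symmetric])
  moreover have "(\<Sum>i\<in>UNIV. index_pos (p i)) = (\<Sum>i\<in>(UNIV :: 'n set). index_pos i)"
    using sum.permute[OF p, of index_pos] by (simp add: o_def)
  ultimately show False
    by simp
qed

text \<open>Every permutation other than the identity sends some index to a smaller one, which puts
  an entry below the diagonal, hence a zero, into its product.\<close>

lemma det_upper_triangular:
  fixes A :: "'n::{finite,linorder} sqmat"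
  assumes A: "\<And>i j. j < i \<Longrightarrow> A $ i $ j = 0"
  shows "det A = (\<Prod>i\<in>UNIV. A $ i $ i)"
proof -
  have "det A = (\<Sum>p\<in>{id}. of_int (sign p) * (\<Prod>i\<in>UNIV. A $ i $ p i))"
    unfolding det_def
  proof (rule sum.mono_neutral_right)
    show "\<forall>p\<in>{p. p permutes UNIV} - {id}. of_int (sign p) * (\<Prod>i\<in>UNIV. A $ i $ p i) = 0"
    proof
      fix p :: "'n \<Rightarrow> 'n" assume "p \<in> {p. p permutes UNIV} - {id}"
      then obtain i where "p i < i"
        using permutes_ge_imp_id[of p] by (auto simp: not_le[symmetric])
      then have "(\<Prod>i\<in>UNIV. A $ i $ p i) = 0"
        using A by auto
      then show "of_int (sign p) * (\<Prod>i\<in>UNIV. A $ i $ p i) = 0"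
        by simp
    qed
  qed (auto simp: permutes_id)
  then show ?thesis
    by (simp add: sign_id)
qed

text \<open>The coefficient of the \<open>k\<close>-th derivative of \<open>f\<close> in the \<open>m\<close>-th derivative of \<open>l f\<close>.\<close>

fun leibniz_coeff :: "(real \<Rightarrow> real) \<Rightarrow> nat \<Rightarrow> nat \<Rightarrow> real \<Rightarrow> real" where
  "leibniz_coeff l 0 k = (if k = 0 then l else (\<lambda>x. 0))"
| "leibniz_coeff l (Suc m) k =
    (\<lambda>x. vderiv (leibniz_coeff l m k) x + (case k of 0 \<Rightarrow> (\<lambda>x. 0) | Suc i \<Rightarrow> leibniz_coeff l m i) x)"

lemma leibniz_coeff_smooth: "l \<in> smooth_loops \<Longrightarrow> leibniz_coeff l m k \<in> smooth_loops"
  by (induction m arbitrary: k)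
    (auto intro!: smooth_loops_add vderiv_smooth_loops smooth_loops_const split: nat.split)

lemma leibniz_coeff_gt: "m < k \<Longrightarrow> leibniz_coeff l m k = (\<lambda>x. 0)"
  by (induction m arbitrary: k) (auto split: nat.split)

text \<open>Together with \<open>leibniz_coeff_gt\<close> this makes the matrix of Leibniz
  coefficients triangular with \<open>l\<close> on its diagonal, so its determinant is a power of
  \<open>l\<close>.\<close>

lemma leibniz_coeff_diag: "leibniz_coeff l m m = l"
  by (induction m) (simp_all add: leibniz_coeff_gt)

lemma loop_deriv_mult:
  assumes l: "l \<in> smooth_loops" and f: "f \<in> smooth_loops"
  shows "loop_deriv m (\<lambda>x. l x * f x) = (\<lambda>x. \<Sum>k\<le>m. leibniz_coeff l m k x * loop_deriv k f x)"
proof (induction m)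
  case (Suc m)
  let ?c = "leibniz_coeff l"
  have "vderiv (\<lambda>x. \<Sum>k\<le>m. ?c m k x * loop_deriv k f x) =
      (\<lambda>x. \<Sum>k\<le>m. ?c m k x * loop_deriv (Suc k) f x + vderiv (?c m k) x * loop_deriv k f x)"
    unfolding loop_deriv_Suc'
    by (intro vderiv_eqI has_vector_derivative_sum has_vector_derivative_mult
        smooth_loops_has_vderiv leibniz_coeff_smooth loop_deriv_smooth_loops l f)
  also have "\<dots> = (\<lambda>x. \<Sum>k\<le>Suc m. ?c (Suc m) k x * loop_deriv k f x)"
  proof
    fix x
    have "(\<Sum>k\<le>Suc m. ?c (Suc m) k x * loop_deriv k f x) =
        (\<Sum>k\<le>Suc m. vderiv (?c m k) x * loop_deriv k f x) +
        (\<Sum>k\<le>Suc m. (case k of 0 \<Rightarrow> (\<lambda>x. 0) | Suc i \<Rightarrow> ?c m i) x * loop_deriv k f x)"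
      by (simp add: distrib_right sum.distrib)
    \<comment> \<open>The top term drops out because the coefficient with index \<open>Suc m\<close>
      in the derivative of order \<open>m\<close> is zero.\<close>
    also have "(\<Sum>k\<le>Suc m. vderiv (?c m k) x * loop_deriv k f x) =
        (\<Sum>k\<le>m. vderiv (?c m k) x * loop_deriv k f x)"
      by (simp add: leibniz_coeff_gt)
    \<comment> \<open>Here it is the term \<open>k = 0\<close> that vanishes; an index shift then
      collects the terms in which \<open>f\<close> was differentiated once more.\<close>
    also have "(\<Sum>k\<le>Suc m. (case k of 0 \<Rightarrow> (\<lambda>x. 0) | Suc i \<Rightarrow> ?c m i) x * loop_deriv k f x) =
        (\<Sum>k\<le>m. ?c m k x * loop_deriv (Suc k) f x)"
      by (subst sum.atMost_Suc_shift) simp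
    finally show "(\<Sum>k\<le>m. ?c m k x * loop_deriv (Suc k) f x + vderiv (?c m k) x * loop_deriv k f x) =
        (\<Sum>k\<le>Suc m. ?c (Suc m) k x * loop_deriv k f x)"
      by (simp add: sum.distrib)
  qed
  finally show ?case
    by (simp only: loop_deriv_Suc' Suc)
qed simp

lemma smooth_loops_scaleR:
  fixes f :: "real \<Rightarrow> real ^ 'n"
  assumes "l \<in> smooth_loops" "f \<in> smooth_loops"
  shows "(\<lambda>x. l x *\<^sub>R f x) \<in> smooth_loops"
  by (rule smooth_loops_vecI) (simp add: smooth_loops_mult smooth_loops_nth assms)

lemma loop_deriv_nth: "f \<in> smooth_loops \<Longrightarrow> loop_deriv k f x $ i = loop_deriv k (\<lambda>x. f x $ i) x"
  by (simp add: loop_deriv_linear[OF bounded_linear_vec_nth])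

text \<open>Each column of the new frame is a Leibniz combination of the old columns up to the same
  position. Thus the old frame is multiplied on the right by a triangular matrix with
  \<open>l x\<close> on the diagonal.\<close>

lemma det_frame_scaleR:
  fixes f :: "real \<Rightarrow> 'n::{finite,linorder} rvec"
  assumes l: "l \<in> smooth_loops" and f: "f \<in> smooth_loops"
  shows "det (frame (\<lambda>x. l x *\<^sub>R f x) x) = l x ^ CARD('n) * det (frame f x)"
proof -
  define U :: "'n sqmat" where "U = (\<chi> k j. leibniz_coeff l (index_pos j) (index_pos k) x)"
  have "frame (\<lambda>x. l x *\<^sub>R f x) x $ i $ j = (frame f x ** U) $ i $ j" for i j
  proof -
    have "frame (\<lambda>x. l x *\<^sub>R f x) x $ i $ j = loop_deriv (index_pos j) (\<lambda>x. l x * f x $ i) x"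
      by (simp add: frame_def loop_deriv_nth smooth_loops_scaleR l f index_pos_def)
    also have "\<dots> = (\<Sum>k\<le>index_pos j. leibniz_coeff l (index_pos j) k x * loop_deriv k f x $ i)"
      by (simp add: loop_deriv_mult smooth_loops_nth l f loop_deriv_nth)
    also have "\<dots> = (\<Sum>k | k \<le> j. leibniz_coeff l (index_pos j) (index_pos k) x * loop_deriv (index_pos k) f x $ i)"
      by (rule sum.reindex_bij_betw[OF bij_betw_index_pos, symmetric])
    also have "\<dots> = (\<Sum>k\<in>(UNIV :: 'n set). leibniz_coeff l (index_pos j) (index_pos k) x * loop_deriv (index_pos k) f x $ i)"
      by (rule sum.mono_neutral_left) (auto simp: leibniz_coeff_gt index_pos_less)
    also have "\<dots> = (frame f x ** U) $ i $ j"
      by (simp add: matrix_matrix_mult_def frame_def U_def index_pos_def mult.commute)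
    finally show ?thesis .
  qed
  then have "frame (\<lambda>x. l x *\<^sub>R f x) x = frame f x ** U"
    by (simp add: vec_eq_iff)
  moreover have "det U = (\<Prod>i\<in>UNIV. U $ i $ i)"
    by (rule det_upper_triangular) (simp add: U_def leibniz_coeff_gt index_pos_less)
  ultimately show ?thesis
    by (simp add: det_mul U_def leibniz_coeff_diag)
qed

section \<open>Inverse matrices and the derivative of the determinant at the identity\<close>

lemma matrix_inv_det:
  fixes A :: "real ^ 'n ^ 'n"
  assumes "det A \<noteq> 0"
  shows "A ** matrix_inv A = mat 1" "matrix_inv A ** A = mat 1"
proof -
  have "\<exists>B. A ** B = mat 1 \<and> B ** A = mat 1"
    using assms by (simp add: invertible_det_nz[symmetric] invertible_def)
  then have "A ** matrix_inv A = mat 1 \<and> matrix_inv A ** A = mat 1"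
    unfolding matrix_inv_def by (rule someI_ex)
  then show "A ** matrix_inv A = mat 1" "matrix_inv A ** A = mat 1"
    by auto
qed

text \<open>Column \<open>j\<close> of the inverse solves the linear system with right-hand side
  \<open>axis j 1\<close>, so Cramer's rule applies. Determinants carry smoothness over to the
  inverse.\<close>

lemma matrix_inv_cramer:
  fixes A :: "real ^ 'n ^ 'n"
  assumes "det A \<noteq> 0"
  shows "matrix_inv A $ k $ j =
    det (\<chi> i l. if l = k then (if i = j then 1 else 0) else A $ i $ l) / det A"
proof -
  have "A *v (matrix_inv A *v axis j 1) = axis j 1"
    by (simp add: matrix_vector_mul_assoc matrix_inv_det assms)
  then have "matrix_inv A *v axis j 1 =
      (\<chi> k. det (\<chi> i l. if l = k then axis j 1 $ i else A $ i $ l) / det A)"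
    using cramer[OF assms] by blast
  then have "(matrix_inv A *v axis j 1) $ k =
      det (\<chi> i l. if l = k then axis j 1 $ i else A $ i $ l) / det A"
    by simp
  moreover have "(matrix_inv A *v axis j 1) $ k = matrix_inv A $ k $ j"
    by (simp add: matrix_vector_mult_basis column_def)
  ultimately show ?thesis
    by (simp add: axis_def eq_commute cong: if_cong)
qed

text \<open>Jacobi's formula at the identity. A permutation other than the identity moves at least
  two points, so after one factor is differentiated another off-diagonal factor still vanishes at
  0.\<close>

lemma DERIV_det_mat_1_add:
  fixes B :: "real ^ 'n ^ 'n"
  shows "((\<lambda>s. det (mat 1 + s *\<^sub>R B)) has_real_derivative trace B) (at 0)"
proof -
  define b where "b i j s = (mat 1 :: real ^ 'n ^ 'n) $ i $ j + s * B $ i $ j" for i j s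
  define T where "T p i = B $ i $ p i * (\<Prod>j\<in>UNIV - {i}. b j (p j) 0)" for p i
  have det: "det (mat 1 + s *\<^sub>R B) =
      (\<Sum>p\<in>{p. p permutes UNIV}. of_int (sign p) * (\<Prod>i\<in>UNIV. b i (p i) s))" for s
    by (simp add: det_def b_def)
  have "((\<lambda>s. \<Prod>i\<in>UNIV. b i (p i) s) has_real_derivative (\<Sum>i\<in>UNIV. T p i)) (at 0)" for p
    unfolding T_def
    by (rule has_field_derivative_prod) (auto simp: b_def intro!: derivative_eq_intros)
  then have "((\<lambda>s. det (mat 1 + s *\<^sub>R B)) has_real_derivative
      (\<Sum>p\<in>{p. p permutes UNIV}. of_int (sign p) * (\<Sum>i\<in>UNIV. T p i))) (at 0)"
    unfolding det by (intro DERIV_sum DERIV_cmult)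
  also have "(\<Sum>p\<in>{p. p permutes UNIV}. of_int (sign p) * (\<Sum>i\<in>UNIV. T p i)) =
      (\<Sum>p\<in>{id}. of_int (sign p) * (\<Sum>i\<in>UNIV. T p i))"
  proof (rule sum.mono_neutral_right)
    have "T p i = 0" if p: "p permutes UNIV" "p \<noteq> id" for p i
    proof -
      \<comment> \<open>If only \<open>i\<close> were moved, its image would be a fixed point,
        against injectivity.\<close>
      have "\<exists>j. j \<noteq> i \<and> p j \<noteq> j"
        using p by (metis bij_def eq_id_iff inj_def permutes_bij)
      then obtain j where "j \<in> UNIV - {i}" "b j (p j) 0 = 0"
        by (auto simp: b_def mat_def)
      then have "(\<Prod>j\<in>UNIV - {i}. b j (p j) 0) = 0"
        by (intro prod_zero) auto
      then show ?thesis
        by (simp add: T_def)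
    qed
    then show "\<forall>p\<in>{p. p permutes UNIV} - {id}. of_int (sign p) * (\<Sum>i\<in>UNIV. T p i) = 0"
      by auto
  qed (auto simp: permutes_id)
  also have "\<dots> = trace B"
    by (simp add: T_def b_def mat_def trace_def sign_id)
  finally show ?thesis .
qed

subsection \<open>The differential of \<open>k\<^sub>1\<close>\<close>

lemma matrix_diff_ldistrib: "A ** (B - C) = A ** B - A ** (C :: 'n::finite sqmat)"
  by (simp add: vec_eq_iff matrix_matrix_mult_def algebra_simps sum_subtractf)

lemma matrix_diff_rdistrib: "(A - B) ** C = A ** C - B ** (C :: 'n::finite sqmat)"
  by (simp add: vec_eq_iff matrix_matrix_mult_def algebra_simps sum_subtractf)

lemma matrix_add_scaleR_rdistrib:
  "(A + s *\<^sub>R B) ** C = A ** C + s *\<^sub>R (B ** (C :: 'n::finite sqmat))"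
  by (simp add: vec_eq_iff matrix_matrix_mult_def algebra_simps sum.distrib sum_distrib_left)

lemma frame_nth: "frame \<gamma> x $ i $ j = loop_deriv (index_pos j) \<gamma> x $ i"
  by (simp add: frame_def index_pos_def)

lemma frame_entry_smooth:
  "\<gamma> \<in> smooth_loops \<Longrightarrow> (\<lambda>x. frame \<gamma> x $ i $ j) \<in> smooth_loops"
  by (simp add: frame_nth smooth_loops_nth loop_deriv_smooth_loops)

lemma frame_smooth: "\<gamma> \<in> smooth_loops \<Longrightarrow> frame \<gamma> \<in> smooth_loops"
  by (rule smooth_loops_vecI, rule smooth_loops_vecI, rule frame_entry_smooth)

lemma frame_entry_variation:
  "smooth_variation \<Gamma> \<delta> \<Longrightarrow>
    smooth_variation (\<lambda>s x. frame (\<Gamma> s) x $ i $ j) (\<lambda>x. frame \<delta> x $ i $ j)"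
  by (simp add: frame_nth smooth_variation_nth smooth_variation_loop_deriv)

lemma frame_add_scaleR:
  assumes "\<gamma> \<in> smooth_loops" "\<delta> \<in> smooth_loops"
  shows "frame (\<lambda>t. \<gamma> t + s *\<^sub>R \<delta> t) x = frame \<gamma> x + s *\<^sub>R frame \<delta> x"
proof -
  have "(\<lambda>t. s *\<^sub>R \<delta> t) \<in> smooth_loops"
    by (rule smooth_loops_linear[OF bounded_linear_scaleR_right assms(2)])
  then show ?thesis
    by (simp add: vec_eq_iff frame_nth loop_deriv_add assms
        loop_deriv_linear[OF bounded_linear_scaleR_right])
qed

lemma smooth_variation_matrix_mult:
  fixes A B :: "real \<Rightarrow> real \<Rightarrow> 'n::finite sqmat"
  assumes "\<And>i j. \<exists>f. smooth_variation (\<lambda>s x. A s x $ i $ j) f"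
    and "\<And>i j. \<exists>f. smooth_variation (\<lambda>s x. B s x $ i $ j) f"
  shows "\<exists>f. smooth_variation (\<lambda>s x. (A s x ** B s x) $ i $ j) f"
proof -
  have "\<exists>f. smooth_variation (\<lambda>s x. A s x $ i $ k * B s x $ k $ j) f" for k
  proof -
    obtain f g where "smooth_variation (\<lambda>s x. A s x $ i $ k) f" "smooth_variation (\<lambda>s x. B s x $ k $ j) g"
      using assms by blast
    from smooth_variation_mult[OF this] show ?thesis
      by blast
  qed
  then show ?thesis
    by (simp add: matrix_matrix_mult_def smooth_variation_sum_ex)
qed

text \<open>With determinant 1, Cramer's rule involves no division: an entry of the inverse is
  itself a determinant of entries of \<open>A\<close> and constants.\<close>

lemma matrix_inv_variation:
  fixes A :: "real \<Rightarrow> real \<Rightarrow> 'n::finite sqmat"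
  assumes A: "\<And>i j. \<exists>f. smooth_variation (\<lambda>s x. A s x $ i $ j) f"
    and det: "\<forall>\<^sub>F s in nhds 0. \<forall>x. det (A s x) = 1"
  shows "\<exists>f. smooth_variation (\<lambda>s x. matrix_inv (A s x) $ k $ j) f"
proof -
  define B :: "real \<Rightarrow> real \<Rightarrow> 'n sqmat"
    where "B s x = (\<chi> i l. if l = k then (if i = j then 1 else 0) else A s x $ i $ l)" for s x
  have eq: "\<forall>\<^sub>F s in nhds 0. (\<lambda>x. matrix_inv (A s x) $ k $ j) = (\<lambda>x. det (B s x))"
    using det by eventually_elim (simp add: B_def matrix_inv_cramer)
  have "\<exists>f. smooth_variation (\<lambda>s x. B s x $ i $ l) f" for i l
    using A smooth_variation_const[OF smooth_loops_const] by (cases "l = k") (auto simp: B_def)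
  then have "\<exists>f. smooth_variation (\<lambda>s x. det (B s x)) f"
    by (rule smooth_variation_det)
  then show ?thesis
    by (simp add: smooth_variation_cong[OF eq])
qed

lemma central_affine_curvesD:
  assumes "\<gamma> \<in> central_affine_curves"
  shows "\<gamma> \<in> smooth_loops" "det (frame \<gamma> x) = 1"
    "frame \<gamma> x ** matrix_inv (frame \<gamma> x) = mat 1" "matrix_inv (frame \<gamma> x) ** frame \<gamma> x = mat 1"
  using assms by (auto simp: central_affine_curves_def matrix_inv_det)

lemma central_affine_curves_variation:
  assumes "\<forall>\<^sub>F s in nhds 0. \<Gamma> s \<in> central_affine_curves" "has_velocity \<Gamma> \<delta>"
  shows "smooth_variation \<Gamma> \<delta>"
  using assms by (auto simp: smooth_variation_def elim!: eventually_mono dest: central_affine_curvesD)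

text \<open>The entries of the frame and, by Cramer's rule, of its inverse have velocities, hence so
  do those of the product. The velocity is identified in \<open>k1_velocity\<close>.\<close>

lemma k1_variation:
  fixes \<Gamma> :: "real \<Rightarrow> real \<Rightarrow> 'n::{finite,linorder} rvec"
  assumes M: "\<forall>\<^sub>F s in nhds 0. \<Gamma> s \<in> central_affine_curves" and vel: "has_velocity \<Gamma> \<delta>"
  shows "\<exists>Y. smooth_variation (\<lambda>s. k1 (\<Gamma> s)) Y"
proof -
  note \<Gamma> = central_affine_curves_variation[OF M vel]
  have fr: "\<exists>f. smooth_variation (\<lambda>s x. frame (\<Gamma> s) x $ i $ j) f" for i j
    using frame_entry_variation[OF \<Gamma>] by blast
  have inv: "\<exists>f. smooth_variation (\<lambda>s x. matrix_inv (frame (\<Gamma> s) x) $ i $ j) f" for i j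
    using M by (intro matrix_inv_variation fr) (auto elim!: eventually_mono dest: central_affine_curvesD)
  have e: "\<exists>f. smooth_variation (\<lambda>s x. (e1n :: 'n sqmat) $ i $ j) f" for i j
    using smooth_variation_const[OF smooth_loops_const] by blast
  have "\<exists>f. smooth_variation (\<lambda>s x. k1 (\<Gamma> s) x $ i $ j) f" for i j
    unfolding k1_def by (intro smooth_variation_matrix_mult fr inv e)
  then have "\<forall>i j. \<exists>f. smooth_variation (\<lambda>s x. k1 (\<Gamma> s) x $ i $ j) f"
    by blast
  then obtain f where f: "\<And>i j. smooth_variation (\<lambda>s x. k1 (\<Gamma> s) x $ i $ j) (f i j)"
    by (simp add: choice_iff) blast
  have "smooth_variation (\<lambda>s. k1 (\<Gamma> s)) (\<lambda>x. \<chi> i j. f i j x)"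
    by (intro smooth_variation_vecI) (simp add: f)
  then show ?thesis
    by blast
qed

text \<open>This is \<delta>g times the inverse of g: the conjugate by g of the matrix occurring in
  \<open>w3_hat\<close>, and the generator of the motion of \<open>k1\<close> in its orbit.\<close>

definition orbit_generator ::
    "(real \<Rightarrow> 'n rvec) \<Rightarrow> (real \<Rightarrow> 'n rvec) \<Rightarrow> real \<Rightarrow> 'n::{finite,linorder} sqmat" where
  "orbit_generator \<gamma> \<delta> x = frame \<delta> x ** matrix_inv (frame \<gamma> x)"

text \<open>Once a velocity \<open>Y\<close> is known to exist, differentiating
  \<open>k g = g e1n\<close> gives \<open>Y g + k \<delta>g = \<delta>g e1n\<close>. Solving for
  \<open>Y\<close> avoids differentiating the inverse of g.\<close>

lemma k1_velocity:
  fixes \<Gamma> :: "real \<Rightarrow> real \<Rightarrow> 'n::{finite,linorder} rvec"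
  assumes M: "\<forall>\<^sub>F s in nhds 0. \<Gamma> s \<in> central_affine_curves" and vel: "has_velocity \<Gamma> \<delta>"
  shows "has_velocity (\<lambda>s. k1 (\<Gamma> s)) (\<lambda>x. bracket (orbit_generator (\<Gamma> 0) \<delta> x) (k1 (\<Gamma> 0) x))"
proof -
  obtain Y where Y: "smooth_variation (\<lambda>s. k1 (\<Gamma> s)) Y"
    using k1_variation[OF assms] by blast
  note \<Gamma> = central_affine_curves_variation[OF M vel]
  have \<Gamma>0: "\<Gamma> 0 \<in> central_affine_curves"
    using eventually_nhds_x_imp_x[OF M] .
  have "Y x = bracket (orbit_generator (\<Gamma> 0) \<delta> x) (k1 (\<Gamma> 0) x)" for x
  proof -
    let ?g = "frame (\<Gamma> 0) x" and ?k = "k1 (\<Gamma> 0) x"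
    have dk: "((\<lambda>s. k1 (\<Gamma> s) x $ i $ j) has_real_derivative Y x $ i $ j) (at 0)" for i j
      using quotient_limit_DERIV[OF smooth_variation_smooth(4)[OF
            smooth_variation_nth[OF smooth_variation_nth[OF Y]]]] .
    have dg: "((\<lambda>s. frame (\<Gamma> s) x $ i $ j) has_real_derivative frame \<delta> x $ i $ j) (at 0)" for i j
      using quotient_limit_DERIV[OF smooth_variation_smooth(4)[OF frame_entry_variation[OF \<Gamma>]]] .
    have "(Y x ** ?g + ?k ** frame \<delta> x) $ i $ j = (frame \<delta> x ** e1n) $ i $ j" for i j
    proof (rule DERIV_unique)
      show "((\<lambda>s. (k1 (\<Gamma> s) x ** frame (\<Gamma> s) x) $ i $ j) has_real_derivative
          (Y x ** ?g + ?k ** frame \<delta> x) $ i $ j) (at 0)"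
        by (auto simp: matrix_matrix_mult_def sum.distrib[symmetric] mult_ac
            intro!: derivative_eq_intros dk dg sum.cong)
      have "((\<lambda>s. (frame (\<Gamma> s) x ** e1n) $ i $ j) has_real_derivative
          (frame \<delta> x ** e1n) $ i $ j) (at 0)"
        by (auto simp: matrix_matrix_mult_def intro!: derivative_eq_intros dk dg)
      moreover have "\<forall>\<^sub>F s in nhds 0.
          (k1 (\<Gamma> s) x ** frame (\<Gamma> s) x) $ i $ j = (frame (\<Gamma> s) x ** e1n) $ i $ j"
        using M by eventually_elim
          (simp add: k1_def matrix_mul_assoc[symmetric] central_affine_curvesD)
      ultimately show "((\<lambda>s. (k1 (\<Gamma> s) x ** frame (\<Gamma> s) x) $ i $ j) has_real_derivative
          (frame \<delta> x ** e1n) $ i $ j) (at 0)"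
        by (simp add: DERIV_cong_ev)
    qed
    then have eq: "Y x ** ?g = frame \<delta> x ** e1n - ?k ** frame \<delta> x"
      by (simp add: vec_eq_iff eq_diff_eq)
    have "Y x = (Y x ** ?g) ** matrix_inv ?g"
      by (simp add: matrix_mul_assoc[symmetric] central_affine_curvesD[OF \<Gamma>0])
    also have "\<dots> = frame \<delta> x ** e1n ** matrix_inv ?g - ?k ** frame \<delta> x ** matrix_inv ?g"
      unfolding eq by (rule matrix_diff_rdistrib)
    \<comment> \<open>Inserting the inverse of g times g after \<delta>g exhibits the generator
      followed by \<open>k1\<close>.\<close>
    also have "frame \<delta> x ** e1n ** matrix_inv ?g = orbit_generator (\<Gamma> 0) \<delta> x ** ?k"
    proof -
      have "orbit_generator (\<Gamma> 0) \<delta> x ** ?k =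
          frame \<delta> x ** (matrix_inv ?g ** ?g) ** e1n ** matrix_inv ?g"
        by (simp only: orbit_generator_def k1_def matrix_mul_assoc)
      then show ?thesis
        by (simp add: central_affine_curvesD[OF \<Gamma>0])
    qed
    finally show ?thesis
      by (simp add: bracket_def orbit_generator_def matrix_mul_assoc)
  qed
  then have "Y = (\<lambda>x. bracket (orbit_generator (\<Gamma> 0) \<delta> x) (k1 (\<Gamma> 0) x))"
    by blast
  with Y show ?thesis
    by (simp add: smooth_variation_def)
qed

section \<open>Curves with a prescribed tangent vector, and the resulting differential\<close>

lemma tangent_vector_realized:
  fixes \<gamma> :: "real \<Rightarrow> 'n::{finite,linorder} rvec"
  assumes \<gamma>: "\<gamma> \<in> central_affine_curves" and \<delta>: "\<delta> \<in> tangent_vectors \<gamma>"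
  obtains \<Gamma> where "\<Gamma> 0 = \<gamma>" "\<forall>\<^sub>F s in nhds 0. \<Gamma> s \<in> central_affine_curves" "has_velocity \<Gamma> \<delta>"
proof -
  define A where "A s = (\<lambda>x. \<gamma> x + s *\<^sub>R \<delta> x)" for s
  define D where "D s x = det (frame (A s) x)" for s x
  \<comment> \<open>Scaling by \<open>l\<close> multiplies the Wronskian by the n-th power of
    \<open>l\<close>; this exponent makes the rescaled Wronskian equal to 1.\<close>
  define a where "a = - 1 / real CARD('n)"
  define \<Gamma> where "\<Gamma> s = (\<lambda>x. (D s x powr a) *\<^sub>R A s x)" for s
  have sm: "\<gamma> \<in> smooth_loops" "\<delta> \<in> smooth_loops"
    using \<gamma> \<delta> by (auto simp: central_affine_curves_def tangent_vectors_def)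
  have s\<delta>: "(\<lambda>x. s *\<^sub>R \<delta> x) \<in> smooth_loops" for s
    by (rule smooth_loops_linear[OF bounded_linear_scaleR_right sm(2)])
  have A_smooth: "A s \<in> smooth_loops" for s
    unfolding A_def by (intro smooth_loops_add sm s\<delta>)
  \<comment> \<open>The family is affine in \<open>s\<close>, so for nonzero \<open>s\<close> each
    quotient already equals its limit.\<close>
  have "quotient_limit (\<lambda>s. loop_deriv k (A s)) (loop_deriv k \<delta>)" for k
    unfolding quotient_limit_def
  proof (rule uniform_limit_cong[THEN iffD1, OF _ _ uniform_limit_const])
    show "\<forall>\<^sub>F s in at 0. \<forall>x\<in>UNIV. loop_deriv k \<delta> x =
        (1 / s) *\<^sub>R (loop_deriv k (A s) x - loop_deriv k (A 0) x)"
      unfolding A_def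
      by (simp add: loop_deriv_add sm s\<delta> smooth_loops_const loop_deriv_linear[OF bounded_linear_scaleR_right] eventually_at_filter)
  qed simp
  then have A: "smooth_variation A \<delta>"
    by (simp add: smooth_variation_iff' A_smooth sm)
  have D0: "D 0 = (\<lambda>x. 1)"
    using \<gamma> by (simp add: fun_eq_iff D_def A_def central_affine_curves_def)
  have "\<exists>f. smooth_variation D f"
    unfolding D_def using frame_entry_variation[OF A] by (intro smooth_variation_det) blast
  then obtain f where f: "smooth_variation D f"
    by blast
  \<comment> \<open>Tangency enters here: it identifies the velocity of the Wronskian, so far only
    known to exist.\<close>
  have "f x = 0" for x
  proof (rule DERIV_unique)
    show "((\<lambda>s. D s x) has_real_derivative f x) (at 0)"
      by (rule quotient_limit_DERIV[OF smooth_variation_smooth(4)[OF f]])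
    show "((\<lambda>s. D s x) has_real_derivative 0) (at 0)"
      using \<delta> by (simp add: tangent_vectors_def D_def A_def)
  qed
  then have "f = (\<lambda>x. 0)"
    by blast
  with f have D: "smooth_variation D (\<lambda>x. 0)"
    by simp
  \<comment> \<open>Uniformity gives a single range of parameters on which \<open>D s\<close> is
    positive along the whole loop.\<close>
  have lim: "uniform_limit UNIV D (D 0) (at 0)"
    using quotient_limit_imp_uniform_limit[OF smooth_variation_smooth(4)[OF D]] by simp
  then have "\<forall>\<^sub>F s in at 0. \<forall>x\<in>UNIV. dist (D s x) 1 < 1"
    using uniform_limitD[OF lim, of 1] by (simp add: D0)
  then have "\<forall>\<^sub>F s in at 0. \<forall>x. D s x > 0"
    by eventually_elim (auto simp: dist_real_def abs_less_iff)
  then have pos: "\<forall>\<^sub>F s in nhds 0. \<forall>x. D s x > 0"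
    using D0 by (simp add: eventually_nhds_conv_at)
  have powr: "smooth_variation (\<lambda>s x. D s x powr a) (\<lambda>x. 0)"
    by (rule smooth_variation_powr[OF D D0 pos])
  have "smooth_variation \<Gamma> \<delta>"
  proof (rule smooth_variation_vecI)
    fix i
    show "smooth_variation (\<lambda>s x. \<Gamma> s x $ i) (\<lambda>x. \<delta> x $ i)"
      \<comment> \<open>The product rule gives \<open>1 * \<delta> + 0 * \<gamma>\<close> in each
        component, so the rescaling does not change the velocity.\<close>
      using smooth_variation_mult[OF powr smooth_variation_nth[OF A, of i]]
      by (simp add: \<Gamma>_def D0)
  qed
  moreover have "\<Gamma> 0 = \<gamma>"
    by (simp add: \<Gamma>_def D0 A_def)
  moreover have "\<forall>\<^sub>F s in nhds 0. \<Gamma> s \<in> central_affine_curves"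
    using pos smooth_variation_smooth(1)[OF powr] smooth_variation_smooth(1)[OF \<open>smooth_variation \<Gamma> \<delta>\<close>]
  proof eventually_elim
    case (elim s)
    have det: "det (frame (\<Gamma> s) x) = 1" for x
    proof -
      have pos: "D s x > 0"
        using elim(1) by blast
      have "det (frame (\<Gamma> s) x) = (D s x powr a) ^ CARD('n) * D s x"
        unfolding \<Gamma>_def by (subst det_frame_scaleR[OF elim(2) A_smooth]) (simp add: D_def)
      also have "(D s x powr a) ^ CARD('n) = D s x powr (a * real CARD('n))"
        using pos by (simp add: powr_powr flip: powr_realpow)
      also have "\<dots> * D s x = 1"
        using pos by (simp add: a_def powr_minus)
      finally show ?thesis .
    qed
    have "\<Gamma> s x \<noteq> 0" for x
    proof
      assume 0: "\<Gamma> s x = 0"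
      \<comment> \<open>The first column of the frame is the curve itself, so a zero of the curve
        would make the determinant vanish.\<close>
      have "index_pos (Min UNIV :: 'n) = 0"
        by (auto simp: index_pos_def)
      then have "column (Min UNIV) (frame (\<Gamma> s) x) = 0"
        using 0 by (simp add: column_def vec_eq_iff frame_nth)
      then have "det (frame (\<Gamma> s) x) = 0"
        by (rule det_zero_column)
      with det show False
        by simp
    qed
    with det elim show ?case
      by (simp add: central_affine_curves_def)
  qed
  ultimately show thesis
    using that by (auto simp: smooth_variation_def)
qed

lemma has_velocity_unique:
  assumes "has_velocity \<Gamma> Y" "has_velocity \<Gamma> Z"
  shows "Y = Z"
proof
  fix x
  have "quotient_limit \<Gamma> Y" "quotient_limit \<Gamma> Z"
    using assms by (auto simp: has_velocity_def quotient_limit_def dest: spec[of _ 0])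
  then show "Y x = Z x"
    by (intro tendsto_unique[OF _ quotient_limit_tendsto quotient_limit_tendsto]) auto
qed

text \<open>The definite description needs both existence, from \<open>k1_velocity\<close>, and
  uniqueness. The latter rests on a curve realizing \<delta>, without which every \<open>Y\<close>
  would satisfy the condition vacuously.\<close>

lemma differential_k1:
  assumes \<gamma>: "\<gamma> \<in> central_affine_curves" and \<delta>: "\<delta> \<in> tangent_vectors \<gamma>"
  shows "differential central_affine_curves k1 \<gamma> \<delta> =
    (\<lambda>x. bracket (orbit_generator \<gamma> \<delta> x) (k1 \<gamma> x))"
  unfolding differential_def
proof (rule the_equality)
  show "\<forall>\<Gamma>. \<Gamma> 0 = \<gamma> \<and> (\<forall>\<^sub>F s in nhds 0. \<Gamma> s \<in> central_affine_curves) \<and> has_velocity \<Gamma> \<delta> \<longrightarrow>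
      has_velocity (\<lambda>s. k1 (\<Gamma> s)) (\<lambda>x. bracket (orbit_generator \<gamma> \<delta> x) (k1 \<gamma> x))"
    using k1_velocity by blast
next
  fix Y
  assume Y: "\<forall>\<Gamma>. \<Gamma> 0 = \<gamma> \<and> (\<forall>\<^sub>F s in nhds 0. \<Gamma> s \<in> central_affine_curves) \<and> has_velocity \<Gamma> \<delta> \<longrightarrow>
      has_velocity (\<lambda>s. k1 (\<Gamma> s)) Y"
  obtain \<Gamma> where \<Gamma>: "\<Gamma> 0 = \<gamma>" "\<forall>\<^sub>F s in nhds 0. \<Gamma> s \<in> central_affine_curves" "has_velocity \<Gamma> \<delta>"
    using tangent_vector_realized[OF assms] .
  show "Y = (\<lambda>x. bracket (orbit_generator \<gamma> \<delta> x) (k1 \<gamma> x))"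
    using Y \<Gamma> k1_velocity[OF \<Gamma>(2,3)] by (intro has_velocity_unique) auto
qed

text \<open>Since \<open>det g = 1\<close>, the determinant of g + s \<delta>g equals that of the
  identity plus \<open>s\<close> times the generator. Its derivative at 0 is the trace, which
  tangency forces to be 0.\<close>

lemma orbit_generator_sl_loops:
  assumes \<gamma>: "\<gamma> \<in> central_affine_curves" and \<delta>: "\<delta> \<in> tangent_vectors \<gamma>"
  shows "orbit_generator \<gamma> \<delta> \<in> sl_loops"
proof -
  have sm: "\<gamma> \<in> smooth_loops" "\<delta> \<in> smooth_loops"
    using \<gamma> \<delta> by (auto simp: central_affine_curves_def tangent_vectors_def)
  have "(\<lambda>x. matrix_inv (frame \<gamma> x) $ k $ j) \<in> smooth_loops" for k j
  proof -
    \<comment> \<open>Smoothness of the inverse is read off at parameter 0 from the family that is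
      constant in \<open>s\<close>.\<close>
    have "\<exists>f. smooth_variation (\<lambda>s x. matrix_inv (frame \<gamma> x) $ k $ j) f"
      using smooth_variation_const[OF frame_entry_smooth[OF sm(1)]] central_affine_curvesD(2)[OF \<gamma>]
      by (intro matrix_inv_variation) auto
    then show ?thesis
      using smooth_variation_smooth(2) by blast
  qed
  then have "orbit_generator \<gamma> \<delta> \<in> smooth_loops"
    by (intro smooth_loops_vecI)
      (simp add: orbit_generator_def matrix_matrix_mult_def smooth_loops_sum smooth_loops_mult
        frame_entry_smooth sm)
  moreover have "trace (orbit_generator \<gamma> \<delta> x) = 0" for x
  proof (rule DERIV_unique[OF DERIV_det_mat_1_add])
    let ?B = "orbit_generator \<gamma> \<delta> x"
    have "det (mat 1 + s *\<^sub>R ?B) = det (frame (\<lambda>t. \<gamma> t + s *\<^sub>R \<delta> t) x)" for s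
    proof -
      have "(mat 1 + s *\<^sub>R ?B) ** frame \<gamma> x = frame (\<lambda>t. \<gamma> t + s *\<^sub>R \<delta> t) x"
        by (simp add: frame_add_scaleR sm matrix_add_scaleR_rdistrib orbit_generator_def
            matrix_mul_assoc[symmetric] central_affine_curvesD[OF \<gamma>])
      from arg_cong[OF this, of det] show ?thesis
        by (simp add: det_mul central_affine_curvesD[OF \<gamma>])
    qed
    then show "((\<lambda>s. det (mat 1 + s *\<^sub>R ?B)) has_real_derivative 0) (at 0)"
      using \<delta> by (simp add: tangent_vectors_def)
  qed
  ultimately show ?thesis
    by (simp add: sl_loops_def)
qed

subsection \<open>The orbit form\<close>

text \<open>Invariance of the trace form under the adjoint action, a consequence of
  cyclicity.\<close>

lemma trace_bracket_left:
  fixes A B C :: "'n::finite sqmat"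
  shows "trace (A ** bracket B C) = trace (bracket A B ** C)"
proof -
  have "trace (A ** (C ** B)) = trace (B ** A ** C)"
    using trace_mul_sym[of B "A ** C"] by (simp add: matrix_mul_assoc)
  then show ?thesis
    by (simp add: bracket_def matrix_diff_ldistrib matrix_diff_rdistrib trace_sub matrix_mul_assoc)
qed

lemma bracket_swap: "bracket A B = - bracket B A"
  by (simp add: bracket_def)

text \<open>Well-definedness of the orbit form: by invariance of the trace form, the value depends
  on \<xi> only through its bracket with \<open>y\<close>, and likewise for \<eta>.\<close>

lemma orbit_form_bracket:
  assumes "\<xi> \<in> sl_loops" "\<eta> \<in> sl_loops"
  shows "orbit_form y (\<lambda>x. bracket (\<xi> x) (y x)) (\<lambda>x. bracket (\<eta> x) (y x)) =
    pairing y (\<lambda>x. bracket (\<xi> x) (\<eta> x))"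
  unfolding orbit_form_def
proof (rule the_equality)
  fix c
  assume "\<exists>\<xi>'\<in>sl_loops. \<exists>\<eta>'\<in>sl_loops.
      (\<lambda>x. bracket (\<xi> x) (y x)) = (\<lambda>x. bracket (\<xi>' x) (y x)) \<and>
      (\<lambda>x. bracket (\<eta> x) (y x)) = (\<lambda>x. bracket (\<eta>' x) (y x)) \<and>
      c = pairing y (\<lambda>x. bracket (\<xi>' x) (\<eta>' x))"
  then obtain \<xi>' \<eta>' where eq: "\<And>x. bracket (\<xi> x) (y x) = bracket (\<xi>' x) (y x)"
      "\<And>x. bracket (\<eta> x) (y x) = bracket (\<eta>' x) (y x)"
    and c: "c = pairing y (\<lambda>x. bracket (\<xi>' x) (\<eta>' x))"
    by (auto simp: fun_eq_iff)
  have "trace (y x ** bracket (\<xi>' x) (\<eta>' x)) = trace (y x ** bracket (\<xi> x) (\<eta> x))" for x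
  proof -
    have "trace (y x ** bracket (\<xi>' x) (\<eta>' x)) = trace (bracket (y x) (\<xi>' x) ** \<eta>' x)"
      by (rule trace_bracket_left)
    also have "\<dots> = trace (bracket (y x) (\<xi> x) ** \<eta>' x)"
      by (simp only: bracket_swap[of "y x"] eq)
    \<comment> \<open>Cyclicity and invariance move the bracket with \<open>y\<close> onto the
      second generator, which can then be exchanged as the first one was.\<close>
    also have "\<dots> = trace (bracket (\<eta>' x) (y x) ** \<xi> x)"
      using trace_mul_sym[of "bracket (y x) (\<xi> x)" "\<eta>' x"] by (simp only: trace_bracket_left)
    also have "\<dots> = trace (bracket (\<eta> x) (y x) ** \<xi> x)"
      by (simp only: eq)
    also have "\<dots> = trace (bracket (y x) (\<xi> x) ** \<eta> x)"
      using trace_mul_sym[of "bracket (y x) (\<xi> x)" "\<eta> x"] by (simp only: trace_bracket_left)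
    also have "\<dots> = trace (y x ** bracket (\<xi> x) (\<eta> x))"
      by (rule trace_bracket_left[symmetric])
    finally show ?thesis .
  qed
  then show "c = pairing y (\<lambda>x. bracket (\<xi> x) (\<eta> x))"
    by (simp add: c pairing_def)
qed (use assms in blast)

text \<open>\<open>k1\<close> and both generators are conjugates by g. Brackets commute with
  conjugation and the trace ignores it, after which invariance moves the bracket onto
  \<open>e1n\<close>.\<close>

lemma pairing_orbit_generator:
  assumes \<gamma>: "\<gamma> \<in> central_affine_curves"
  shows "pairing (k1 \<gamma>) (\<lambda>x. bracket (orbit_generator \<gamma> \<delta>\<^sub>1 x) (orbit_generator \<gamma> \<delta>\<^sub>2 x)) =
    w3_hat \<gamma> \<delta>\<^sub>1 \<delta>\<^sub>2"
proof -
  have "trace (k1 \<gamma> x ** bracket (orbit_generator \<gamma> \<delta>\<^sub>1 x) (orbit_generator \<gamma> \<delta>\<^sub>2 x)) =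
      trace (bracket e1n (matrix_inv (frame \<gamma> x) ** frame \<delta>\<^sub>1 x) ** (matrix_inv (frame \<gamma> x) ** frame \<delta>\<^sub>2 x))" for x
  proof -
    let ?g = "frame \<gamma> x" and ?h = "matrix_inv (frame \<gamma> x)"
    let ?A = "?h ** frame \<delta>\<^sub>1 x" and ?B = "?h ** frame \<delta>\<^sub>2 x"
    have conj: "orbit_generator \<gamma> \<delta> x = ?g ** (?h ** frame \<delta> x) ** ?h" for \<delta>
      by (simp add: orbit_generator_def matrix_mul_assoc central_affine_curvesD[OF \<gamma>])
    have cancel: "P ** ?h ** ?g = P" for P
      by (simp add: matrix_mul_assoc[symmetric] central_affine_curvesD[OF \<gamma>])
    have "k1 \<gamma> x ** bracket (orbit_generator \<gamma> \<delta>\<^sub>1 x) (orbit_generator \<gamma> \<delta>\<^sub>2 x) =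
        ?g ** (e1n ** bracket ?A ?B ** ?h)"
      by (simp add: conj bracket_def k1_def matrix_diff_ldistrib matrix_diff_rdistrib matrix_mul_assoc cancel)
    then have "trace (k1 \<gamma> x ** bracket (orbit_generator \<gamma> \<delta>\<^sub>1 x) (orbit_generator \<gamma> \<delta>\<^sub>2 x)) =
        trace (e1n ** bracket ?A ?B ** ?h ** ?g)"
      by (simp only: trace_mul_sym[of ?g])
    then show ?thesis
      by (simp only: cancel trace_bracket_left)
  qed
  then show ?thesis
    by (simp add: pairing_def w3_hat_def)
qed

theorem theorem6p10:
  assumes "CARD('n::{finite,linorder}) \<ge> 2"
  shows "(k1 :: (real \<Rightarrow> 'n rvec) \<Rightarrow> real \<Rightarrow> 'n sqmat) \<in> central_affine_curves \<rightarrow> O1 \<and>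
    (\<forall>\<gamma> \<in> (central_affine_curves :: (real \<Rightarrow> 'n rvec) set).
       \<forall>\<delta>\<^sub>1 \<in> tangent_vectors \<gamma>. \<forall>\<delta>\<^sub>2 \<in> tangent_vectors \<gamma>.
         pullback central_affine_curves k1 orbit_form \<gamma> \<delta>\<^sub>1 \<delta>\<^sub>2 = w3_hat \<gamma> \<delta>\<^sub>1 \<delta>\<^sub>2)"
proof (intro conjI ballI funcsetI)
  fix \<gamma> :: "real \<Rightarrow> 'n rvec"
  assume "\<gamma> \<in> central_affine_curves"
  \<comment> \<open>The moving frame itself is the conjugating loop that places
    \<open>k1 \<gamma>\<close> in the orbit.\<close>
  then have "frame \<gamma> \<in> SL_loops"
    by (simp add: SL_loops_def frame_smooth central_affine_curvesD)
  then show "k1 \<gamma> \<in> O1"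
    by (auto simp: O1_def adjoint_orbit_def k1_def fun_eq_iff)
next
  fix \<gamma> \<delta>\<^sub>1 \<delta>\<^sub>2 :: "real \<Rightarrow> 'n rvec"
  assume "\<gamma> \<in> central_affine_curves" "\<delta>\<^sub>1 \<in> tangent_vectors \<gamma>" "\<delta>\<^sub>2 \<in> tangent_vectors \<gamma>"
  then show "pullback central_affine_curves k1 orbit_form \<gamma> \<delta>\<^sub>1 \<delta>\<^sub>2 = w3_hat \<gamma> \<delta>\<^sub>1 \<delta>\<^sub>2"
    by (simp add: pullback_def differential_k1 orbit_form_bracket orbit_generator_sl_loops
        pairing_orbit_generator)
qed

end
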